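(* Let $m\ge1$. For each $r=0,1,\dots,m$, the Koornwinder polynomial attached to the column $(1^r)$ is $$P_{(1^r)}(z;a,b,c,d|q,t)=\sum_{l=0}^{r}\frac{\langle t^{m-r+1}\rangle_{t,l}\,\langle t^{m-r}ab\rangle_{t,l}\,\langle t^{m-r}ac\rangle_{t,l}\,\langle t^{m-r}ad\rangle_{t,l}}{\langle t\rangle_{t,l}\,\langle t^{2(m-r)}abcd\rangle_{t,l}}\,E_{r-l}(z;a|t),$$ where, for $0\le s\le m$, $$E_s(z;a|t)=\sum_{1\le i_1<\cdots<i_s\le m}\langle z_{i_1};t^{i_1-1}a\rangle\langle z_{i_2};t^{i_2-2}a\rangle\cdots\langle z_{i_s};t^{i_s-s}a\rangle .$$
   Context: Notation: $\langle z\rangle=z^{1/2}-z^{-1/2}$; $\langle z;w\rangle=\langle zw\rangle\langle z/w\rangle=z+z^{-1}-w-w^{-1}$; $\langle u\rangle_{t,l}=\langle u\rangle\langle tu\rangle\cdots\langle t^{l-1}u\rangle$. $\mathbb{K}=\mathbb{Q}(a^{1/2},b^{1/2},c^{1/2},d^{1/2},q^{1/2},t^{1/2})$ is the field of rational functions in indeterminates (the square roots of the parameters); square roots of monomials in the parameters are the corresponding monomials in these indeterminates. $z=(z_1,\dots,z_m)$ and $W=\{\pm1\}^m\rtimes\mathfrak{S}_m$ acts on $\mathbb{K}[z_1^{\pm1},\dots,z_m^{\pm1}]$ by permuting and inverting the variables. Koornwinder's $q$-difference operator is $$\mathcal{D}_z=\sum_{i=1}^{m}\mathcal{A}_i^{+}(z)(T_{q,z_i}-1)+\sum_{i=1}^{m}\mathcal{A}_i^{-}(z)(T_{q,z_i}^{-1}-1),$$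 $$\mathcal{A}_i^{+}(z)=\frac{(1-az_i)(1-bz_i)(1-cz_i)(1-dz_i)}{(abcdq^{-1})^{1/2}t^{m-1}(1-z_i^2)(1-qz_i^2)}\prod_{j\ne i}\frac{(1-tz_iz_j)(1-tz_iz_j^{-1})}{(1-z_iz_j)(1-z_iz_j^{-1})},\qquad \mathcal{A}_i^{-}(z)=\mathcal{A}_i^{+}(z^{-1}),$$ where $T_{q,z_i}$ replaces $z_i$ by $qz_i$ and $z^{-1}=(z_1^{-1},\dots,z_m^{-1})$. For a partition $\lambda=(\lambda_1\ge\cdots\ge\lambda_m\ge0)$, the Koornwinder polynomial $P_\lambda(z)=P_\lambda(z;a,b,c,d|q,t)$ is the unique $W$-invariant Laurent polynomial in $\mathbb{K}[z^{\pm1}]$ such that (i) $P_\lambda=m_\lambda+\sum_{\mu<\lambda}c_{\lambda,\mu}m_\mu$ with $c_{\lambda,\mu}\in\mathbb{K}$, where $m_\mu(z)=\sum_{\nu\in W\mu}z^\nu$ is the orbit sum and $\mu\le\lambda$ is the dominance ordering ($\mu_1+\cdots+\mu_i\le\lambda_1+\cdots+\lambda_i$ for all $i=1,\dots,m$, with no equality of total weights required); (ii) $\mathcal{D}_zP_\lambda=d_\lambda P_\lambda$ for some $d_\lambda\in\mathbb{K}$. *)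

theory Defs
  imports
    "HOL-Library.Poly_Mapping"
    "HOL-Library.FuncSet"
    "HOL-Combinatorics.Permutations"
    "HOL-Computational_Algebra.Polynomial_Factorial"
begin

section \<open>The coefficient field and its parameters\<close>

text \<open>The field of rational functions over the rationals in six indeterminates, which are the
  square roots of the parameters, obtained by iterating univariate polynomials.\<close>

type_synonym coef = "rat poly poly poly poly poly poly fract"

definition root_a :: coef where "root_a = to_fract [:[:[:[:[:[:0, 1:]:]:]:]:]:]"
definition root_b :: coef where "root_b = to_fract [:[:[:[:[:0, 1:]:]:]:]:]"
definition root_c :: coef where "root_c = to_fract [:[:[:[:0, 1:]:]:]:]"
definition root_d :: coef where "root_d = to_fract [:[:[:0, 1:]:]:]"
definition root_q :: coef where "root_q = to_fract [:[:0, 1:]:]"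
definition root_t :: coef where "root_t = to_fract [:0, 1:]"

definition par_a :: coef where "par_a = root_a ^ 2"
definition par_b :: coef where "par_b = root_b ^ 2"
definition par_c :: coef where "par_c = root_c ^ 2"
definition par_d :: coef where "par_d = root_d ^ 2"
definition par_q :: coef where "par_q = root_q ^ 2"
definition par_t :: coef where "par_t = root_t ^ 2"

text \<open>The brackets involve square roots of monomials in the parameters, so the functions below
  receive the square root: \<open>bracket x\<close> is \<open>\<langle>x\<^sup>2\<rangle>\<close>, and \<open>bracket_fact x l\<close> is
  \<open>\<langle>x\<^sup>2\<rangle>\<^sub>t\<^sub>,\<^sub>l\<close>, the product of the \<open>\<langle>t\<^sup>k x\<^sup>2\<rangle>\<close> for \<open>k < l\<close>.\<close>

definition bracket :: "coef \<Rightarrow> coef" where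
  "bracket x = x - inverse x"

definition bracket_fact :: "coef \<Rightarrow> nat \<Rightarrow> coef" where
  "bracket_fact x l = (\<Prod>k<l. bracket (root_t ^ k * x))"

section \<open>Laurent polynomials and rational functions in the variables\<close>

text \<open>Exponent vectors are finitely supported integer sequences; multiplication of \<open>laurent\<close> is
  the convolution product. The ring has variables \<open>z\<^sub>i\<close> for all natural numbers \<open>i\<close>; the Laurent
  polynomials in \<open>z\<^sub>1, \<dots>, z\<^sub>m\<close> are singled out by \<open>laurent_in\<close>.\<close>

type_synonym laurent = "(nat \<Rightarrow>\<^sub>0 int) \<Rightarrow>\<^sub>0 coef"
type_synonym ratfun = "laurent fract"

definition laurent_in :: "nat \<Rightarrow> laurent set" where
  "laurent_in m = {P. \<forall>\<nu>\<in>Poly_Mapping.keys P. Poly_Mapping.keys \<nu> \<subseteq> {1..m}}"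

definition lconst :: "coef \<Rightarrow> laurent" where
  "lconst c = Poly_Mapping.single 0 c"

definition lvar_pow :: "nat \<Rightarrow> int \<Rightarrow> laurent" where
  "lvar_pow i e = Poly_Mapping.single (Poly_Mapping.single i e) 1"

definition zvar :: "nat \<Rightarrow> ratfun" where
  "zvar i = to_fract (lvar_pow i 1)"

text \<open>Substitution of \<open>f i\<close> for \<open>z\<^sub>i\<close>; meaningful when the \<open>f i\<close> are nonzero.\<close>

definition lsubst :: "(nat \<Rightarrow> ratfun) \<Rightarrow> laurent \<Rightarrow> ratfun" where
  "lsubst f P = (\<Sum>\<nu>\<in>Poly_Mapping.keys P. to_fract (lconst (Poly_Mapping.lookup P \<nu>)) *
      (\<Prod>i\<in>Poly_Mapping.keys \<nu>. f i powi Poly_Mapping.lookup \<nu> i))"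

section \<open>The Weyl group, partitions and orbit sums\<close>

definition sign_vector :: "nat \<Rightarrow> (nat \<Rightarrow> int) \<Rightarrow> bool" where
  "sign_vector m \<epsilon> \<longleftrightarrow> (\<forall>i\<in>{1..m}. \<epsilon> i = 1 \<or> \<epsilon> i = -1)"

definition W_invariant :: "nat \<Rightarrow> laurent \<Rightarrow> bool" where
  "W_invariant m P \<longleftrightarrow>
     (\<forall>\<sigma> \<epsilon>. \<sigma> permutes {1..m} \<and> sign_vector m \<epsilon> \<longrightarrow>
        lsubst (\<lambda>i. zvar (\<sigma> i) powi \<epsilon> i) P = to_fract P)"

text \<open>A partition with at most \<open>m\<close> parts is \<open>i \<mapsto> \<lambda>\<^sub>i\<close>, extended by zero outside \<open>{1..m}\<close>.\<close>

definition partitions_le :: "nat \<Rightarrow> (nat \<Rightarrow> nat) set" where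
  "partitions_le m = {\<mu>. (\<forall>i\<in>{1..m}. \<forall>j\<in>{1..m}. i \<le> j \<longrightarrow> \<mu> j \<le> \<mu> i) \<and>
      (\<forall>i. i \<notin> {1..m} \<longrightarrow> \<mu> i = 0)}"

definition dominated :: "nat \<Rightarrow> (nat \<Rightarrow> nat) \<Rightarrow> (nat \<Rightarrow> nat) \<Rightarrow> bool" where
  "dominated m \<mu> lam \<longleftrightarrow> (\<forall>i\<in>{1..m}. (\<Sum>j=1..i. \<mu> j) \<le> (\<Sum>j=1..i. lam j))"

definition W_orbit :: "nat \<Rightarrow> (nat \<Rightarrow> nat) \<Rightarrow> (nat \<Rightarrow>\<^sub>0 int) set" where
  "W_orbit m \<mu> = {\<nu>. \<exists>\<sigma> \<epsilon>. \<sigma> permutes {1..m} \<and> sign_vector m \<epsilon> \<and>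
      (\<forall>i. Poly_Mapping.lookup \<nu> i = (if i \<in> {1..m} then \<epsilon> i * int (\<mu> (\<sigma> i)) else 0))}"

definition orbit_sum :: "nat \<Rightarrow> (nat \<Rightarrow> nat) \<Rightarrow> laurent" where
  "orbit_sum m \<mu> = (\<Sum>\<nu>\<in>W_orbit m \<mu>. Poly_Mapping.single \<nu> 1)"

section \<open>Koornwinder's operator and polynomials\<close>

text \<open>The coefficient \<open>\<A>\<^sub>i\<^sup>+\<close> is a function of the point \<open>z\<close>, so that \<open>\<A>\<^sub>i\<^sup>-\<close> is literally
  its value at the inverted point.\<close>

definition koornwinder_A_plus :: "nat \<Rightarrow> nat \<Rightarrow> (nat \<Rightarrow> ratfun) \<Rightarrow> ratfun" where
  "koornwinder_A_plus m i z =
     (let C = (\<lambda>x. to_fract (lconst x)) in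
      ((1 - C par_a * z i) * (1 - C par_b * z i) * (1 - C par_c * z i) * (1 - C par_d * z i)) /
      (C (root_a * root_b * root_c * root_d / root_q) * C par_t ^ (m - 1) *
        (1 - z i ^ 2) * (1 - C par_q * z i ^ 2)) *
      (\<Prod>j\<in>{1..m} - {i}.
        ((1 - C par_t * z i * z j) * (1 - C par_t * z i * inverse (z j))) /
        ((1 - z i * z j) * (1 - z i * inverse (z j)))))"

definition koornwinder_A_minus :: "nat \<Rightarrow> nat \<Rightarrow> (nat \<Rightarrow> ratfun) \<Rightarrow> ratfun" where
  "koornwinder_A_minus m i z = koornwinder_A_plus m i (\<lambda>j. inverse (z j))"

definition q_shift :: "nat \<Rightarrow> laurent \<Rightarrow> ratfun" where
  "q_shift i = lsubst (zvar(i := to_fract (lconst par_q) * zvar i))"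

definition q_shift_inv :: "nat \<Rightarrow> laurent \<Rightarrow> ratfun" where
  "q_shift_inv i = lsubst (zvar(i := to_fract (lconst (inverse par_q)) * zvar i))"

definition koornwinder_D :: "nat \<Rightarrow> laurent \<Rightarrow> ratfun" where
  "koornwinder_D m P =
     (\<Sum>i=1..m. koornwinder_A_plus m i zvar * (q_shift i P - to_fract P)) +
     (\<Sum>i=1..m. koornwinder_A_minus m i zvar * (q_shift_inv i P - to_fract P))"

definition is_koornwinder :: "nat \<Rightarrow> (nat \<Rightarrow> nat) \<Rightarrow> laurent \<Rightarrow> bool" where
  "is_koornwinder m lam P \<longleftrightarrow>
     P \<in> laurent_in m \<and> W_invariant m P \<and>
     (\<exists>c. P = orbit_sum m lam +
        (\<Sum>\<mu> | \<mu> \<in> partitions_le m \<and> dominated m \<mu> lam \<and> \<mu> \<noteq> lam.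
           lconst (c \<mu>) * orbit_sum m \<mu>)) \<and>
     (\<exists>d. koornwinder_D m P = to_fract (lconst d) * to_fract P)"

text \<open>For a partition, existence and uniqueness of the polynomial are Koornwinder's theorem.\<close>

definition koornwinder :: "nat \<Rightarrow> (nat \<Rightarrow> nat) \<Rightarrow> laurent" where
  "koornwinder m lam = (THE P. is_koornwinder m lam P)"

section \<open>Columns and the polynomials \<open>E\<^sub>s\<close>\<close>

definition column :: "nat \<Rightarrow> nat \<Rightarrow> nat" where
  "column r i = (if i \<in> {1..r} then 1 else 0)"

text \<open>\<open>\<langle>z\<^sub>i; w\<rangle> = z\<^sub>i + z\<^sub>i\<^sup>-\<^sup>1 - w - w\<^sup>-\<^sup>1\<close> for a scalar \<open>w\<close>.\<close>

definition bracket2 :: "nat \<Rightarrow> coef \<Rightarrow> laurent" where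
  "bracket2 i w = lvar_pow i 1 + lvar_pow i (-1) - lconst w - lconst (inverse w)"

text \<open>The sum runs over the strictly increasing index tuples \<open>i\<^sub>1 < \<dots> < i\<^sub>s\<close> in \<open>{1..m}\<close>, for
  which \<open>i\<^sub>k \<ge> k\<close>, so the natural-number subtraction does not truncate.\<close>

definition E_poly :: "nat \<Rightarrow> nat \<Rightarrow> coef \<Rightarrow> coef \<Rightarrow> laurent" where
  "E_poly m s a t =
     (\<Sum>i | i \<in> {1..s} \<rightarrow>\<^sub>E {1..m} \<and> strict_mono_on {1..s} i.
        \<Prod>k=1..s. bracket2 (i k) (t ^ (i k - k) * a))"

end

theory Submission
  imports Defs
begin

text \<open>
  Write \<open>x\<^sub>i = z\<^sub>i + 1/z\<^sub>i\<close>, let \<open>a\<^sub>k = t\<^sup>k a + 1/(t\<^sup>k a)\<close> and let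
  \<open>N\<^sub>k(y) = (y - a\<^sub>0) \<cdots> (y - a\<^sub>k\<^sub>-\<^sub>1)\<close> be the Newton basis with these nodes. The polynomials \<open>E\<^sub>s\<close>
  are, up to sign, the coefficients of the generating function \<open>\<Prod>\<^sub>j (y - x\<^sub>j)\<close> in the Newton basis
  (lemma \<open>prod_linear_newton_expansion\<close>). Since Newton coefficients are unique, this makes the
  Weyl group invariance of \<open>E\<^sub>s\<close> evident. Changing all nodes to \<open>0\<close> turns \<open>E\<^sub>s\<close> into the
  elementary symmetric polynomial in the \<open>x\<^sub>i\<close>, that is, into the orbit sum of the column \<open>(1\<^sup>s)\<close>;
  the change of nodes is unitriangular.

  The heart of the matter is that Koornwinder's operator maps \<open>E\<^sub>s\<close> to a combination of \<open>E\<^sub>s\<close> and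
  \<open>E\<^sub>s\<^sub>-\<^sub>1\<close> only. Apply the operator to the generating function. As the latter has degree one in
  each \<open>x\<^sub>i\<close>, the factors \<open>1 - q z\<^sub>i\<^sup>2\<close> in the denominators cancel, and the result is a polynomial
  of degree less than \<open>m\<close> in \<open>y\<close>, determined by its values at \<open>y = x\<^sub>1, \<dots>, x\<^sub>m\<close>. At \<open>y = x\<^sub>i\<close> all
  summands but the \<open>i\<close>-th vanish, and that summand is, up to sign, an Askey-Wilson type operator
  with shift \<open>t\<close>, acting on the variable \<open>y = Y + 1/Y\<close> of the generating function at \<open>Y = z\<^sub>i\<close>. So
  the action on the variables \<open>z\<close> is traded for an action on the single variable \<open>y\<close>, in which
  only the Newton basis occurs; there the one-variable operator takes \<open>N\<^sub>k\<close> to a combination of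
  \<open>N\<^sub>k\<close> and \<open>N\<^sub>k\<^sub>-\<^sub>1\<close> (lemma \<open>Psi_newton_two_term\<close>). Comparing Newton coefficients gives lemma
  \<open>difference_op_interp_esym\<close>.

  The partitions dominated by \<open>(1\<^sup>r)\<close> are the columns \<open>(1\<^sup>s)\<close> with \<open>s \<le> r\<close>, so the candidates for
  the Koornwinder polynomial are the sums \<open>\<Sum> u\<^sub>s E\<^sub>s\<close> over \<open>s \<le> r\<close> with \<open>u\<^sub>r = 1\<close>. For such a sum
  the eigenvalue equation is a first-order recursion for \<open>u\<close> (lemma \<open>is_koornwinder_column_iff\<close>).
  The eigenvalues of different columns differ, their differences being products of brackets (lemma
  \<open>eigenvalue_difference\<close>), so the recursion has exactly one solution, and it is the quotient of
  shifted factorials in the theorem. This settles existence, uniqueness and the explicit formula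
  at the same time.
\<close>

section \<open>Newton interpolation and the polynomials \<open>E\<^sub>s\<close>\<close>

definition newton_basis :: "(nat \<Rightarrow> 'a::comm_ring_1) \<Rightarrow> nat \<Rightarrow> 'a poly" where
  "newton_basis a k = (\<Prod>i<k. [:- a i, 1:])"

text \<open>The polynomial \<open>E\<^sub>s\<close> of the variables \<open>x\<^sub>1, \<dots>, x\<^sub>m\<close> for arbitrary nodes. In the recursion,
  an increasing tuple of length \<open>s + 1\<close> with entries at most \<open>m + 1\<close> either avoids \<open>m + 1\<close> or ends
  with it, and in the second case it skips \<open>m - s\<close> of the smaller indices, which is the index of
  the node. For zero nodes this is the elementary symmetric polynomial.\<close>

fun interp_esym :: "(nat \<Rightarrow> 'a::comm_ring_1) \<Rightarrow> (nat \<Rightarrow> 'a) \<Rightarrow> nat \<Rightarrow> nat \<Rightarrow> 'a" where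
  "interp_esym a x m 0 = 1"
| "interp_esym a x 0 (Suc s) = 0"
| "interp_esym a x (Suc m) (Suc s) =
     interp_esym a x m (Suc s) + (x (Suc m) - a (m - s)) * interp_esym a x m s"

lemma interp_esym_eq_0: "m < s \<Longrightarrow> interp_esym a x m s = 0"
  by (induction a x m s rule: interp_esym.induct) auto

lemma newton_basis_0 [simp]: "newton_basis a 0 = 1"
  by (simp add: newton_basis_def)

lemma newton_basis_Suc: "newton_basis a (Suc k) = newton_basis a k * [:- a k, 1:]"
  by (simp add: newton_basis_def)

text \<open>The induction step splits \<open>y - x\<^sub>m\<^sub>+\<^sub>1 = (y - a\<^sub>m\<^sub>-\<^sub>s) - (x\<^sub>m\<^sub>+\<^sub>1 - a\<^sub>m\<^sub>-\<^sub>s)\<close> next to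
  \<open>N\<^sub>m\<^sub>-\<^sub>s\<close>: the first part raises the degree of the basis element, the second one yields the last
  summand of the recursion.\<close>

lemma prod_linear_newton_expansion:
  "(\<Prod>j=1..m. [:- x j, 1:]) =
     (\<Sum>s\<le>m. smult ((-1) ^ s * interp_esym a x m s) (newton_basis a (m - s)))"
proof (induction m)
  case 0
  then show ?case by simp
next
  case (Suc m)
  let ?e = "\<lambda>s. (-1) ^ s * interp_esym a x m s"
  let ?N = "newton_basis a"
  \<comment> \<open>Insert and subtract the node \<open>a\<^sub>m\<^sub>-\<^sub>s\<close>, which turns \<open>N\<^sub>m\<^sub>-\<^sub>s\<close> into the next basis element.\<close>
  have step: "?N (m - s) * [:- x (Suc m), 1:] =
      ?N (Suc m - s) - smult (x (Suc m) - a (m - s)) (?N (m - s))" if "s \<le> m" for s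
    using that by (simp add: Suc_diff_le newton_basis_Suc smult_diff_left algebra_simps)
  have "(\<Prod>j=1..Suc m. [:- x j, 1:]) =
      (\<Sum>s\<le>m. smult (?e s) (?N (m - s))) * [:- x (Suc m), 1:]"
    by (simp only: Suc.IH [symmetric]) (simp del: mult_pCons_right)
  also have "\<dots> = (\<Sum>s\<le>m. smult (?e s) (?N (m - s) * [:- x (Suc m), 1:]))"
    by (simp add: sum_distrib_right del: mult_pCons_right)
  also have "\<dots> = (\<Sum>s\<le>m. smult (?e s) (?N (Suc m - s)))
      - (\<Sum>s\<le>m. smult (?e s * (x (Suc m) - a (m - s))) (?N (m - s)))"
    by (simp add: step smult_diff_right sum_subtractf del: mult_pCons_right)
  also have "(\<Sum>s\<le>m. smult (?e s) (?N (Suc m - s))) = (\<Sum>s\<le>Suc m. smult (?e s) (?N (Suc m - s)))"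
    by (simp add: interp_esym_eq_0)
  also have "\<dots> = ?N (Suc m) + (\<Sum>s\<le>m. smult (?e (Suc s)) (?N (m - s)))"
    by (simp only: sum.atMost_Suc_shift) simp
  also have "\<dots> - (\<Sum>s\<le>m. smult (?e s * (x (Suc m) - a (m - s))) (?N (m - s))) =
      ?N (Suc m) + (\<Sum>s\<le>m. smult ((-1) ^ Suc s * interp_esym a x (Suc m) (Suc s)) (?N (m - s)))"
    unfolding add_diff_eq [symmetric] sum_subtractf [symmetric] smult_diff_left [symmetric]
    by (intro arg_cong2 [where f = "(+)"] sum.cong arg_cong2 [where f = smult])
      (simp_all add: algebra_simps)
  also have "\<dots> = (\<Sum>s\<le>Suc m. smult ((-1) ^ s * interp_esym a x (Suc m) s) (?N (Suc m - s)))"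
    by (simp only: sum.atMost_Suc_shift) simp
  finally show ?case .
qed

lemma degree_newton_basis_le: "degree (newton_basis a k) \<le> k"
proof (induction k)
  case (Suc k)
  show ?case
    by (simp only: newton_basis_Suc)
      (rule order.trans [OF degree_mult_le], use Suc.IH in simp)
qed simp

lemma coeff_newton_basis: "k \<le> n \<Longrightarrow> coeff (newton_basis a k) n = (if k = n then 1 else 0)"
proof (induction k arbitrary: n)
  case 0
  then show ?case by simp
next
  case (Suc k)
  then obtain n' where n: "n = Suc n'" by (cases n) auto
  have "coeff (newton_basis a k) n = 0"
    using Suc.prems degree_newton_basis_le [of a k] by (intro coeff_eq_0) simp
  then show ?case
    using Suc.IH [of n'] Suc.prems n by (simp add: newton_basis_Suc)
qed

text \<open>The \<open>k\<close>-th basis element is monic of degree \<open>k\<close>, so the top coefficient can be read off.\<close>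

lemma newton_basis_independent:
  assumes "(\<Sum>k\<le>n. smult (u k) (newton_basis a k)) = 0" and "k \<le> n"
  shows "u k = 0"
  using assms
proof (induction n)
  case 0
  then show ?case by simp
next
  case (Suc n)
  have "coeff (\<Sum>k\<le>n. smult (u k) (newton_basis a k)) (Suc n) = 0"
    by (simp add: coeff_sum coeff_newton_basis)
  then have "u (Suc n) = 0"
    using arg_cong [OF Suc.prems(1), of "\<lambda>p. coeff p (Suc n)"] by (simp add: coeff_newton_basis)
  then show ?case
    using Suc by (cases "k = Suc n") auto
qed

lemma newton_coeffs_unique:
  assumes "(\<Sum>s\<le>m. smult (u s) (newton_basis a (m - s))) =
           (\<Sum>s\<le>m. smult (v s) (newton_basis a (m - s)))" and "s \<le> m"
  shows "u s = v s"
proof -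
  have "(\<Sum>k\<le>m. smult (u (m - k) - v (m - k)) (newton_basis a k)) =
      (\<Sum>s\<le>m. smult (u s - v s) (newton_basis a (m - s)))"
    by (rule sum.reindex_bij_witness [of _ "\<lambda>s. m - s" "\<lambda>s. m - s"]) auto
  also have "\<dots> = 0"
    using assms(1) by (simp add: smult_diff_left sum_subtractf)
  finally show ?thesis
    using newton_basis_independent [where u = "\<lambda>k. u (m - k) - v (m - k)" and k = "m - s"] assms(2)
    by fastforce
qed

text \<open>Sort the tuples by whether their last entry is the largest possible index.\<close>

lemma interp_esym_eq_sum_increasing_tuples:
  "(\<Sum>i | i \<in> {1..s} \<rightarrow>\<^sub>E {1..m} \<and> strict_mono_on {1..s} i. \<Prod>k=1..s. x (i k) - a (i k - k)) =
   interp_esym a x m s"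
proof (induction a x m s rule: interp_esym.induct)
  case (1 a x m)
  have "{i. i \<in> {1..0::nat} \<rightarrow>\<^sub>E {1..m} \<and> strict_mono_on {1..0} i} = {\<lambda>_. undefined}"
    by (auto simp: strict_mono_on_def)
  then show ?case by simp
next
  case (2 a x s)
  have "{i. i \<in> {1..Suc s} \<rightarrow>\<^sub>E {1..0::nat} \<and> strict_mono_on {1..Suc s} i} = {}"
    by (auto simp: PiE_def Pi_def)
  then show ?case by (simp only: sum.empty interp_esym.simps)
next
  case (3 a x m s)
  define T :: "nat \<Rightarrow> nat \<Rightarrow> (nat \<Rightarrow> nat) set"
    where "T n r = {i. i \<in> {1..r} \<rightarrow>\<^sub>E {1..n} \<and> strict_mono_on {1..r} i}" for n r
  have fin: "finite (T n r)" for n r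
    by (rule finite_subset [OF _ finite_PiE [of "{1..r}" "\<lambda>_. {1..n}"]]) (auto simp: T_def)
  let ?ext = "\<lambda>i. i(Suc s := Suc m)"
  have T: "T (Suc m) (Suc s) = T m (Suc s) \<union> ?ext ` T m s"
  proof (intro equalityI subsetI)
    fix i assume i: "i \<in> T (Suc m) (Suc s)"
    have le: "i k < i (Suc s)" if "k \<in> {1..s}" for k
      using i that by (auto simp: T_def strict_mono_on_def)
    show "i \<in> T m (Suc s) \<union> ?ext ` T m s"
    proof (cases "i (Suc s) = Suc m")
      case True
      have "restrict i {1..s} \<in> T m s"
        using i le True by (fastforce simp: T_def strict_mono_on_def PiE_def Pi_def)
      moreover have "i = ?ext (restrict i {1..s})"
        using i True by (fastforce simp: T_def PiE_def extensional_def restrict_def)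
      ultimately show ?thesis by blast
    next
      case False
      have "i (Suc s) \<in> {1..Suc m}" using i by (auto simp: T_def)
      then have "i (Suc s) \<le> m" using False by auto
      moreover have "i k \<le> i (Suc s)" if "k \<in> {1..Suc s}" for k
        using le [of k] that by (cases "k = Suc s") auto
      ultimately have "i k \<in> {1..m}" if "k \<in> {1..Suc s}" for k
        using i that by (force simp: T_def PiE_def Pi_def)
      then show ?thesis using i by (auto simp: T_def PiE_def)
    qed
  next
    fix i assume "i \<in> T m (Suc s) \<union> ?ext ` T m s"
    then show "i \<in> T (Suc m) (Suc s)"
    proof
      assume "i \<in> T m (Suc s)"
      then show ?thesis by (fastforce simp: T_def PiE_def Pi_def)
    next
      assume "i \<in> ?ext ` T m s"
      then obtain j where j: "j \<in> T m s" "i = ?ext j" by auto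
      have "j k \<le> m" "j k \<ge> 1" if "k \<in> {1..s}" for k using j that
          by (auto simp: T_def PiE_def Pi_def)
      then show ?thesis
        using j by (auto simp: T_def PiE_def Pi_def extensional_def strict_mono_on_def le_Suc_eq
            less_Suc_eq_le)
    qed
  qed
  have disj: "T m (Suc s) \<inter> ?ext ` T m s = {}"
    by (auto simp: T_def PiE_def Pi_def)
  have inj: "inj_on ?ext (T m s)"
  proof (rule inj_onI)
    fix i j assume ij: "i \<in> T m s" "j \<in> T m s" "?ext i = ?ext j"
    then have "i (Suc s) = undefined" "j (Suc s) = undefined"
      by (auto simp: T_def PiE_def extensional_def)
    then show "i = j" using ij(3) by (metis fun_upd_triv fun_upd_upd)
  qed
  have "(\<Sum>i\<in>?ext ` T m s. \<Prod>k=1..Suc s. x (i k) - a (i k - k)) =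
      (\<Sum>i\<in>T m s. (x (Suc m) - a (m - s)) * (\<Prod>k=1..s. x (i k) - a (i k - k)))"
    by (simp add: sum.reindex [OF inj] mult.commute)
  then have "(\<Sum>i\<in>T (Suc m) (Suc s). \<Prod>k=1..Suc s. x (i k) - a (i k - k)) =
      (\<Sum>i\<in>T m (Suc s). \<Prod>k=1..Suc s. x (i k) - a (i k - k)) +
      (x (Suc m) - a (m - s)) * (\<Sum>i\<in>T m s. \<Prod>k=1..s. x (i k) - a (i k - k))"
    unfolding T using disj fin by (subst sum.union_disjoint) (auto simp: sum_distrib_left)
  then show ?case using 3 by (simp add: T_def)
qed

lemma interp_esym_cong:
  assumes "\<And>i. i \<in> {1..m} \<Longrightarrow> x i = y i"
  shows "interp_esym a x m s = interp_esym a y m s"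
  using assms by (induction a x m s rule: interp_esym.induct) auto

text \<open>The entries of the transition matrix between two Newton bases. The recursion is the
  splitting \<open>y - a\<^sub>k = (y - b\<^sub>i) + (b\<^sub>i - a\<^sub>k)\<close>.\<close>

fun node_change :: "(nat \<Rightarrow> 'a::comm_ring_1) \<Rightarrow> (nat \<Rightarrow> 'a) \<Rightarrow> nat \<Rightarrow> nat \<Rightarrow> 'a" where
  "node_change a b 0 i = (if i = 0 then 1 else 0)"
| "node_change a b (Suc k) i =
     (if i = 0 then 0 else node_change a b k (i - 1)) + (b i - a k) * node_change a b k i"

lemma node_change_above: "k < i \<Longrightarrow> node_change a b k i = 0"
  by (induction k arbitrary: i) auto

lemma node_change_diag: "node_change a b k k = 1"
  by (induction k) (auto simp: node_change_above)

lemma newton_basis_node_change: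
  "newton_basis a k = (\<Sum>i\<le>k. smult (node_change a b k i) (newton_basis b i))"
proof (induction k)
  case 0
  then show ?case by simp
next
  case (Suc k)
  let ?c = "node_change a b k"
  have "newton_basis a (Suc k) = (\<Sum>i\<le>k. smult (?c i) (newton_basis b i)) * [:- a k, 1:]"
    by (simp only: newton_basis_Suc Suc.IH)
  also have "\<dots> = (\<Sum>i\<le>k. smult (?c i) (newton_basis b (Suc i)) +
      smult ((b i - a k) * ?c i) (newton_basis b i))"
    unfolding sum_distrib_right
    by (intro sum.cong refl) (simp add: newton_basis_Suc algebra_simps smult_diff_left
        smult_add_left smult_diff_right)
  also have "\<dots> = (\<Sum>i\<le>k. smult (?c i) (newton_basis b (Suc i))) +
      (\<Sum>i\<le>Suc k. smult ((b i - a k) * ?c i) (newton_basis b i))"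
    by (simp add: sum.distrib node_change_above)
  also have "(\<Sum>i\<le>k. smult (?c i) (newton_basis b (Suc i))) =
      (\<Sum>i\<le>Suc k. smult (if i = 0 then 0 else ?c (i - 1)) (newton_basis b i))"
    by (simp only: sum.atMost_Suc_shift) simp
  finally show ?case
    by (simp add: smult_add_left sum.distrib del: sum.atMost_Suc)
qed

lemma smult_sum_right: "smult c (\<Sum>i\<in>A. p i) = (\<Sum>i\<in>A. smult c (p i))"
  by (induction A rule: infinite_finite_induct) (simp_all add: smult_add_right)

text \<open>Expand the generating function in the basis with nodes \<open>a\<close> and then re-expand in the basis
  with nodes \<open>b\<close>. Taking one of the two families to be zero relates \<open>E\<^sub>s\<close> to the elementary
  symmetric polynomials in both directions.\<close>

lemma interp_esym_node_change:
  assumes s: "s \<le> m"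
  shows "interp_esym b x m s =
    (\<Sum>j\<le>s. (-1) ^ (s - j) * node_change a b (m - j) (m - s) * interp_esym a x m j)"
proof -
  let ?c = "node_change a b"
  have "(\<Sum>s\<le>m. smult ((-1) ^ s * interp_esym b x m s) (newton_basis b (m - s))) =
     (\<Sum>j\<le>m. smult ((-1) ^ j * interp_esym a x m j) (newton_basis a (m - j)))"
    by (simp only: prod_linear_newton_expansion [symmetric])
  also have "\<dots> = (\<Sum>j\<le>m. \<Sum>s\<in>{j..m}. smult ((-1) ^ j * interp_esym a x m j *
      ?c (m - j) (m - s)) (newton_basis b (m - s)))"
  proof (intro sum.cong refl)
    fix j assume "j \<in> {..m}"
    then have "(\<Sum>i\<le>m - j. smult (?c (m - j) i) (newton_basis b i)) =
        (\<Sum>s\<in>{j..m}. smult (?c (m - j) (m - s)) (newton_basis b (m - s)))"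
      by (intro sum.reindex_bij_witness [of _ "\<lambda>s. m - s" "\<lambda>i. m - i"]) auto
    then show "smult ((-1) ^ j * interp_esym a x m j) (newton_basis a (m - j)) =
        (\<Sum>s\<in>{j..m}. smult ((-1) ^ j * interp_esym a x m j *
            ?c (m - j) (m - s)) (newton_basis b (m - s)))"
      unfolding newton_basis_node_change [of a "m - j" b] by (simp add: smult_sum_right)
  qed
  also have "\<dots> = (\<Sum>s\<le>m. \<Sum>j\<le>s. smult ((-1) ^ j * interp_esym a x m j *
      ?c (m - j) (m - s)) (newton_basis b (m - s)))"
    unfolding sum.Sigma [OF finite_atMost ballI [OF finite_atLeastAtMost]] sum.Sigma
        [OF finite_atMost ballI [OF finite_atMost]]
    by (rule sum.reindex_bij_witness [of _ prod.swap prod.swap]) auto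
  also have "\<dots> = (\<Sum>s\<le>m. smult (\<Sum>j\<le>s. (-1) ^ j * interp_esym a x m j *
      ?c (m - j) (m - s)) (newton_basis b (m - s)))"
    by (simp add: smult_sum)
  finally have eq: "(-1) ^ s * interp_esym b x m s =
      (\<Sum>j\<le>s. (-1) ^ j * interp_esym a x m j * ?c (m - j) (m - s))"
    by (rule newton_coeffs_unique [OF _ s])
  have "interp_esym b x m s = (-1) ^ s * ((-1) ^ s * interp_esym b x m s)"
    by (simp add: mult.assoc [symmetric] power_mult_distrib [symmetric])
  also have "\<dots> = (\<Sum>j\<le>s. (-1) ^ (s - j) * ?c (m - j) (m - s) * interp_esym a x m j)"
    unfolding eq sum_distrib_left
  proof (intro sum.cong refl)
    fix j assume "j \<in> {..s}"
    then obtain l where "s = l + j" by (metis atMost_iff le_Suc_ex add.commute)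
    then show "(-1) ^ s * ((-1) ^ j * interp_esym a x m j * ?c (m - j) (m - s)) =
        (-1) ^ (s - j) * ?c (m - j) (m - s) * interp_esym a x m j"
      by (simp add: power_add mult_ac)
  qed
  finally show ?thesis .
qed

text \<open>The generating function is visibly symmetric, and its Newton coefficients are unique.\<close>

lemma interp_esym_permute:
  assumes "\<sigma> permutes {1..m}" "s \<le> m"
  shows "interp_esym a (\<lambda>i. x (\<sigma> i)) m s = interp_esym a x m s"
proof -
  have "(\<Prod>j=1..m. [:- x (\<sigma> j), 1:]) = (\<Prod>j=1..m. [:- x j, 1:])"
    using prod.permute [OF assms(1), of "\<lambda>j. [:- x j, 1:]"] by (simp add: comp_def)
  then have "(-1) ^ s * interp_esym a (\<lambda>i. x (\<sigma> i)) m s = (-1) ^ s * interp_esym a x m s"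
    unfolding prod_linear_newton_expansion [where a = a]
    by (rule newton_coeffs_unique [OF _ assms(2)])
  then have "(-1) ^ s * ((-1) ^ s * interp_esym a (\<lambda>i. x (\<sigma> i)) m s) = (-1) ^ s *
      ((-1) ^ s * interp_esym a x m s)"
    by simp
  then show ?thesis by (simp add: mult.assoc [symmetric] power_mult_distrib [symmetric])
qed

text \<open>The embeddings of scalars and of Laurent polynomials into rational functions, and the
  substitutions, are ring homomorphisms and therefore commute with the formation of \<open>E\<^sub>s\<close>.\<close>

locale ring_hom =
  fixes h :: "'a::comm_ring_1 \<Rightarrow> 'b::comm_ring_1"
  assumes hom_add: "h (x + y) = h x + h y" and hom_mult: "h (x * y) = h x * h y" and hom_1:
      "h 1 = 1"
begin

lemma hom_0: "h 0 = 0"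
  using hom_add [of 0 0] by simp

lemma hom_minus: "h (- x) = - h x"
  using hom_add [of x "- x"] hom_0 by (simp add: eq_neg_iff_add_eq_0 add.commute)

lemma hom_diff: "h (x - y) = h x - h y"
  using hom_add [of x "- y"] hom_minus by simp

lemma hom_sum: "h (sum f A) = (\<Sum>i\<in>A. h (f i))"
  by (induction A rule: infinite_finite_induct) (simp_all add: hom_0 hom_add)

lemma hom_power: "h (x ^ n) = h x ^ n"
  by (induction n) (simp_all add: hom_1 hom_mult)

lemma hom_interp_esym:
  "h (interp_esym a x m s) = interp_esym (\<lambda>k. h (a k)) (\<lambda>i. h (x i)) m s"
  by (induction a x m s rule: interp_esym.induct)
      (simp_all add: hom_0 hom_1 hom_add hom_mult hom_diff)

lemma hom_node_change:
  "h (node_change a b k i) = node_change (\<lambda>k. h (a k)) (\<lambda>k. h (b k)) k i"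
  by (induction k arbitrary: i) (simp_all add: hom_0 hom_1 hom_add hom_mult hom_diff)

end

section \<open>A two-term difference equation for the Newton basis\<close>

text \<open>The bracket \<open>\<langle>x\<^sup>2\<rangle>\<close> over any field; it is used both for scalars and for rational functions
  in \<open>z\<close>.\<close>

definition angle :: "'a::field \<Rightarrow> 'a" where
  "angle x = x - inverse x"

definition joukowski :: "'a::field \<Rightarrow> 'a" where
  "joukowski x = x + inverse x"

lemma joukowski_inverse [simp]: "joukowski (inverse x) = joukowski x"
  by (simp add: joukowski_def add.commute)

lemma joukowski_scale_diff:
  assumes "c \<noteq> 0" "u \<noteq> 0"
  shows "joukowski (c * u) - joukowski u = (c - 1) * (c * u ^ 2 - 1) / (c * u)"
  using assms by (simp add: joukowski_def field_simps power2_eq_square)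

text \<open>The sum is invariant under \<open>y \<mapsto> 1/y\<close>, its apparent poles at \<open>y\<^sup>2 = 1\<close> cancel, and it grows
  linearly at infinity. So it is an affine function of \<open>y + 1/y\<close>, determined by its leading
  coefficient and its value at \<open>y = p\<^sup>2\<close>, where the second summand vanishes.\<close>

lemma four_parameter_symmetrisation:
  fixes y :: "'a::field"
  assumes nz: "y \<noteq> 0" "p \<noteq> 0" "b \<noteq> 0" "c \<noteq> 0" "d \<noteq> 0" and y: "y ^ 2 \<noteq> 1"
  shows "(1 - p^2 * y) * (1 - b^2 * y) * (1 - c^2 * y) * (1 - d^2 * y) /
      (p * b * c * d * y^2 * (y - inverse y)) +
         (1 - p^2 * inverse y) * (1 - b^2 * inverse y) * (1 - c^2 * inverse y) *
             (1 - d^2 * inverse y) /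
           (p * b * c * d * inverse y^2 * (inverse y - y)) =
         angle (p * b * c * d) * (joukowski y - joukowski (p^2)) + angle (p * b) * angle (p * c) *
             angle (p * d)"
proof -
  \<comment> \<open>With names for the inverses the claim is a polynomial identity modulo the relations
    between the variables and their inverses.\<close>
  define w where "w = inverse (y ^ 2 - 1)"
  have yw: "(y ^ 2 - 1) * w = 1" using y by (simp add: w_def)
  have 1: "inverse (y - inverse y) = y * w" "inverse (inverse y - y) = - y * w"
    using nz y by (simp_all add: w_def divide_simps power2_eq_square) (simp add: algebra_simps)
  define p' b' c' d' y' where "p' = inverse p" "b' = inverse b" "c' = inverse c" "d' = inverse d"
      "y' = inverse y"
  have i: "p * p' = 1" "b * b' = 1" "c * c' = 1" "d * d' = 1" "y * y' = 1"
    using nz by (simp_all add: p'_b'_c'_d'_y'_def)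
  have "(1 - p^2 * y) * (1 - b^2 * y) * (1 - c^2 * y) * (1 - d^2 * y) *
      (p' * b' * c' * d' * y' ^ 2 * (y * w)) +
         (1 - p^2 * y') * (1 - b^2 * y') * (1 - c^2 * y') * (1 - d^2 * y') *
           (p' * b' * c' * d' * y ^ 2 * (- y * w)) =
         (p * b * c * d - p' * b' * c' * d') * (y + y' - (p^2 + p' ^ 2)) + (p * b - p' * b') *
             (p * c - p' * c') * (p * d - p' * d')"
    using i yw by algebra
  moreover have "inverse (y ^ 2) = y' ^ 2" "inverse (y' ^ 2) = y ^ 2" "inverse (p ^ 2) = p' ^ 2"
    "inverse (y - y') = y * w" "inverse (y' - y) = - y * w"
    using 1 by (simp_all add: p'_b'_c'_d'_y'_def power_inverse)
  ultimately show ?thesis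
    by (simp only: divide_inverse angle_def joukowski_def inverse_mult_distrib
        flip: p'_b'_c'_d'_y'_def)
qed

text \<open>Square roots of \<open>a\<close>, \<open>b\<close>, \<open>c\<close>, \<open>d\<close>, \<open>q\<close> and \<open>t\<close> in a field. The locale has two instances:
  the field of coefficients, where the closed formulas live, and the field of rational functions
  in \<open>z\<close>, where the operator acts.\<close>

locale koornwinder_parameters =
  fixes \<alpha> \<beta> \<gamma> \<delta> \<rho> \<tau> :: "'a::field"
  assumes nonzero: "\<alpha> \<noteq> 0" "\<beta> \<noteq> 0" "\<gamma> \<noteq> 0" "\<delta> \<noteq> 0" "\<rho> \<noteq> 0" "\<tau> \<noteq> 0"
    and t_neq_1: "\<tau> ^ 2 \<noteq> 1"
begin

definition node :: "nat \<Rightarrow> 'a" where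
  "node k = joukowski ((\<tau>^2)^k * \<alpha>^2)"

definition newton :: "nat \<Rightarrow> 'a \<Rightarrow> 'a" where
  "newton k y = poly (newton_basis node k) y"

text \<open>This is \<open>\<langle>ay\<rangle>\<langle>by\<rangle>\<langle>cy\<rangle>\<langle>dy\<rangle> / \<langle>y\<^sup>2\<rangle>\<close>, written so that no square root of \<open>y\<close> occurs.\<close>

definition \<Phi> :: "'a \<Rightarrow> 'a" where
  "\<Phi> y = (1 - \<alpha>^2 * y) * (1 - \<beta>^2 * y) * (1 - \<gamma>^2 * y) * (1 - \<delta>^2 * y) /
     (\<alpha> * \<beta> * \<gamma> * \<delta> * y^2 * (y - inverse y))"

text \<open>The coefficient of the one-variable operator
  \<open>f \<mapsto> \<Psi>(y) (f(ty) - f(y)) + \<Psi>(1/y) (f(y/t) - f(y))\<close> that acts on functions of \<open>y + 1/y\<close>.\<close>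

definition \<Psi> :: "'a \<Rightarrow> 'a" where
  "\<Psi> y = \<Phi> y / (joukowski (\<tau>^2 * y) - joukowski y)"

text \<open>Together with \<open>lower_coeff\<close> these are the coefficients of the two-term action of the
  one-variable operator: here \<open>\<langle>t\<^sup>k\<rangle> \<langle>t\<^sup>k\<^sup>-\<^sup>1abcd\<rangle> / \<langle>t\<rangle>\<close>. The exponent \<open>k - 1\<close> is written as a
  division by \<open>\<tau>\<close>, so that the formula is right for \<open>k = 0\<close> as well, where the first bracket is
  zero.\<close>

definition diag_coeff :: "nat \<Rightarrow> 'a" where
  "diag_coeff k = angle (\<tau>^k) * angle (\<tau>^k * (\<alpha> * \<beta> * \<gamma> * \<delta> / \<tau>)) / angle \<tau>"

definition lower_coeff :: "nat \<Rightarrow> 'a" where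
  "lower_coeff k = angle (\<tau>^k) * angle (\<tau>^k * (\<alpha> * \<beta> / \<tau>)) * angle (\<tau>^k * (\<alpha> * \<gamma> / \<tau>)) *
     angle (\<tau>^k * (\<alpha> * \<delta> / \<tau>)) / angle \<tau>"

lemma newton_0 [simp]: "newton 0 y = 1"
  by (simp add: newton_def)

lemma newton_Suc: "newton (Suc k) y = newton k y * (y - node k)"
  by (simp add: newton_def newton_basis_Suc algebra_simps)

text \<open>The factor of \<open>N\<^sub>k\<close> with node \<open>a\<^sub>i\<close> is proportional to \<open>(1 - t\<^sup>i a y) (1 - t\<^sup>i a/y)\<close>.
  Replacing \<open>y\<close> by \<open>ty\<close> moves the two products over \<open>i\<close> by one step in opposite directions, so all
  but a few factors agree with those of \<open>N\<^sub>n(y)\<close>. The multiplier \<open>1 - a y\<close> on the left, a factor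
  of \<open>\<Phi>\<close>, avoids a division.\<close>

lemma newton_shift:
  assumes "y \<noteq> 0"
  shows "(1 - \<alpha>^2 * y) * newton (Suc n) (joukowski (\<tau>^2 * y)) * ((\<tau>^2)^n * \<alpha>^2) =
     - newton n (joukowski y) * (1 - (\<tau>^2)^n * \<alpha>^2 * y) * (1 - (\<tau>^2)^(Suc n) * \<alpha>^2 * y) *
       (1 - \<alpha>^2 * inverse (\<tau>^2) * inverse y)"
proof (induction n)
  case 0
  show ?case
  proof -
    define a t where "a = \<alpha>^2" and "t = \<tau>^2"
    define a' t' y' where "a' = inverse a" "t' = inverse t" "y' = inverse y"
    have "a * a' = 1" "t * t' = 1" "y * y' = 1"
      using nonzero assms by (simp_all add: a'_t'_y'_def a_def t_def)
    then have "(1 - a * y) * (t * y + t' * y' - (a + a')) * a =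
        - (1 - a * y) * (1 - t * a * y) * (1 - a * t' * y')"
      by algebra
    then show ?thesis
      by (simp add: newton_Suc node_def joukowski_def flip: a_def t_def a'_t'_y'_def)
  qed
next
  case (Suc n)
  define N where "N = newton n (joukowski y)"
  define M where "M = newton (Suc n) (joukowski (\<tau>^2 * y))"
  define P where "P = (\<tau>^2)^n"
  define a t where "a = \<alpha>^2" and "t = \<tau>^2"
  define P' a' t' y' where "P' = inverse P" "a' = inverse a" "t' = inverse t" "y' = inverse y"
  have i: "P * P' = 1" "a * a' = 1" "t * t' = 1" "y * y' = 1"
    using nonzero assms by (simp_all add: P'_a'_t'_y'_def P_def a_def t_def)
  have IH: "(1 - a * y) * M * (P * a) = - N * (1 - P * a * y) * (1 - t * P * a * y) *
      (1 - a * t' * y')"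
    using Suc.IH by (simp add: M_def N_def P_def a_def t_def P'_a'_t'_y'_def)
  have "(1 - a * y) * (M * (t * y + t' * y' - (t * P * a + t' * P' * a'))) * (t * P * a) =
      - (N * (y + y' - (P * a + P' * a'))) * (1 - t * P * a * y) * (1 - t * (t * P) * a * y) *
          (1 - a * t' * y')"
    using IH i by algebra
  moreover have "newton (Suc (Suc n)) (joukowski (\<tau>^2 * y)) = M *
      (t * y + t' * y' - (t * P * a + t' * P' * a'))"
    by (simp add: newton_Suc [of "Suc n"] M_def)
      (simp add: node_def joukowski_def P'_a'_t'_y'_def P_def a_def t_def mult_ac)
  moreover have "newton (Suc n) (joukowski y) = N * (y + y' - (P * a + P' * a'))"
    by (simp add: newton_Suc N_def) (simp add: node_def joukowski_def P'_a'_t'_y'_def P_def a_def)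
  ultimately show ?case
    by (simp add: P_def a_def t_def P'_a'_t'_y'_def)
qed

lemma angle_eq: "x \<noteq> 0 \<Longrightarrow> angle x = (x ^ 2 - 1) / x" for x :: 'a
  by (simp add: angle_def field_simps power2_eq_square)

text \<open>After the common factors given by \<open>newton_shift\<close> are taken out, the bracket that remains is
  divisible by \<open>ty + 1/(ty) - y - 1/y\<close>, the denominator of \<open>\<Psi>\<close>; in the quotient the parameter \<open>a\<close>
  has been replaced by \<open>t\<^sup>n a\<close>.\<close>

lemma newton_difference:
  assumes y: "y \<noteq> 0" "\<tau>^2 * y ^ 2 \<noteq> 1"
  shows "\<Psi> y * (newton (Suc n) (joukowski (\<tau>^2 * y)) - newton (Suc n) (joukowski y)) =
    angle (\<tau> ^ Suc n) / angle \<tau> * newton n (joukowski y) *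
      ((1 - (\<tau>^n * \<alpha>)^2 * y) * (1 - \<beta>^2 * y) * (1 - \<gamma>^2 * y) * (1 - \<delta>^2 * y) /
        (\<tau>^n * \<alpha> * \<beta> * \<gamma> * \<delta> * y^2 * (y - inverse y)))"
proof -
  define N where "N = newton n (joukowski y)"
  define M where "M = newton (Suc n) (joukowski (\<tau>^2 * y))"
  define M' where "M' = newton (Suc n) (joukowski y)"
  define p where "p = \<tau>^n"
  define a t where "a = \<alpha>^2" and "t = \<tau>^2"
  define p' a' t' y' where "p' = inverse p" "a' = inverse a" "t' = inverse t" "y' = inverse y"
  have pt: "(\<tau>^2)^n = p^2" by (simp add: p_def power_mult [symmetric] mult.commute)
  have i: "p * p' = 1" "a * a' = 1" "t * t' = 1" "y * y' = 1"
    using nonzero y by (simp_all add: p'_a'_t'_y'_def p_def a_def t_def)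
  have sh: "(1 - a * y) * M * (p^2 * a) = - N * (1 - p^2 * a * y) * (1 - t * p^2 * a * y) *
      (1 - a * t' * y')"
    using newton_shift [of y n] y by (simp add: M_def N_def pt a_def t_def p'_a'_t'_y'_def)
  have M': "M' = N * (y + y' - (p^2 * a + p'^2 * a'))"
    by (simp add: M'_def N_def newton_Suc node_def joukowski_def pt a_def power_inverse
        p'_a'_t'_y'_def)
  define s where "s = joukowski (t * y) - joukowski y"
  have s: "s = t * y + t' * y' - (y + y')"
    by (simp add: s_def joukowski_def p'_a'_t'_y'_def)
  have "s * (t * y) = (t - 1) * (t * y^2 - 1)"
    using s i by algebra
  then have snz: "s \<noteq> 0" using y t_neq_1 by (auto simp: t_def)
  define u where "u = angle (\<tau> ^ Suc n) / angle \<tau>"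
  have "angle \<tau> * \<tau> = t - 1"
    using nonzero by (simp add: angle_eq t_def)
  moreover have "angle (\<tau> ^ Suc n) * (\<tau> * p) = t * p^2 - 1"
    using nonzero by (simp add: angle_eq t_def p_def power2_eq_square mult_ac)
  moreover have "u * angle \<tau> = angle (\<tau> ^ Suc n)"
    using nonzero t_neq_1 by (simp add: u_def angle_eq)
  ultimately have u: "u * ((t - 1) * p) = t * p^2 - 1"
    by algebra
  have anz: "a \<noteq> 0" and pnz: "p \<noteq> 0" using nonzero by (simp_all add: a_def p_def)
  have "p^2 * a * (y + y' - (p^2 * a + p'^2 * a')) = - (1 - p^2 * a * y) * (1 - p^2 * a * y')"
    using i by algebra
  then have M'': "(1 - a * y) * M' * (p^2 * a) = - N * (1 - a * y) * (1 - p^2 * a * y) *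
      (1 - p^2 * a * y')"
    unfolding M' by algebra
  have B: "(1 - a * y) * (1 - p^2 * a * y') - (1 - t * p^2 * a * y) * (1 - a * t' * y') =
      a * (t * p^2 - 1) * (y - t' * y')"
    using i by algebra
  have s': "s = (t - 1) * (y - t' * y')"
    unfolding s using i by algebra
  have "(p * a) * ((1 - a * y) * (M - M') * p) = (1 - a * y) * M * (p^2 * a) - (1 - a * y) * M' *
      (p^2 * a)"
    by (simp add: algebra_simps power2_eq_square)
  also have "\<dots> = N * (1 - p^2 * a * y) *
      ((1 - a * y) * (1 - p^2 * a * y') - (1 - t * p^2 * a * y) * (1 - a * t' * y'))"
    unfolding sh M'' by (simp add: algebra_simps)
  also have "\<dots> = (p * a) * (s * u * N * (1 - p^2 * a * y))"
    unfolding B u [symmetric] s' by (simp add: mult_ac)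
  finally have key: "(1 - a * y) * (M - M') * p = s * u * N * (1 - p^2 * a * y)"
    using anz pnz by simp
  define R where "R = (1 - \<beta>^2 * y) * (1 - \<gamma>^2 * y) * (1 - \<delta>^2 * y)"
  define Q where "Q = \<alpha> * \<beta> * \<gamma> * \<delta> * y^2 * (y - inverse y)"
  have "\<Psi> y * (M - M') = (1 - a * y) * (M - M') * p * R / (Q * s * p)"
    using pnz by (simp add: \<Psi>_def \<Phi>_def R_def Q_def s_def t_def a_def mult_ac)
  also have "\<dots> = u * N * ((1 - p^2 * a * y) * R / (p * Q))"
    unfolding key using snz by (simp add: mult_ac)
  finally show ?thesis
    by (simp add: M_def M'_def N_def p_def u_def R_def Q_def a_def t_def power_mult_distrib mult_ac)
qed

text \<open>The contributions of \<open>y\<close> and \<open>1/y\<close> from \<open>newton_difference\<close> are the two summands of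
  \<open>four_parameter_symmetrisation\<close> with \<open>p\<^sup>2 = t\<^sup>n a\<close>. Its right-hand side is a multiple of
  \<open>y + 1/y - a\<^sub>n\<close>, which completes \<open>N\<^sub>n\<close> to \<open>N\<^sub>n\<^sub>+\<^sub>1\<close>, plus a constant.\<close>

lemma Psi_newton_two_term:
  assumes y: "y \<noteq> 0" "y ^ 2 \<noteq> 1" "\<tau>^2 * y ^ 2 \<noteq> 1" "y ^ 2 \<noteq> \<tau>^2"
  shows "\<Psi> y * (newton k (joukowski (\<tau>^2 * y)) - newton k (joukowski y)) +
      \<Psi> (inverse y) * (newton k (joukowski (\<tau>^2 * inverse y)) - newton k (joukowski y)) =
    diag_coeff k * newton k (joukowski y) + lower_coeff k * newton (k - 1) (joukowski y)"
proof (cases k)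
  case 0
  then show ?thesis by (simp add: diag_coeff_def lower_coeff_def angle_def)
next
  case (Suc n)
  define N where "N = newton n (joukowski y)"
  define u where "u = angle (\<tau> ^ Suc n) / angle \<tau>"
  define p where "p = \<tau> ^ n * \<alpha>"
  have "(\<tau>^2) * (inverse y)^2 \<noteq> 1"
    using y by (simp add: field_simps)
  then have "\<Psi> y * (newton k (joukowski (\<tau>^2 * y)) - newton k (joukowski y)) +
      \<Psi> (inverse y) * (newton k (joukowski (\<tau>^2 * inverse y)) - newton k (joukowski y)) =
    u * N * ((1 - p^2 * y) * (1 - \<beta>^2 * y) * (1 - \<gamma>^2 * y) * (1 - \<delta>^2 * y) /
         (p * \<beta> * \<gamma> * \<delta> * y^2 * (y - inverse y)) +
      (1 - p^2 * inverse y) * (1 - \<beta>^2 * inverse y) * (1 - \<gamma>^2 * inverse y) *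
          (1 - \<delta>^2 * inverse y) /
         (p * \<beta> * \<gamma> * \<delta> * inverse y^2 * (inverse y - y)))"
    using newton_difference [of y n] newton_difference [of "inverse y" n] y
    by (simp only: Suc joukowski_inverse inverse_inverse_eq inverse_nonzero_iff_nonzero
        flip: N_def u_def p_def) (simp add: distrib_left)
  also have "\<dots> = u * N * (angle (p * \<beta> * \<gamma> * \<delta>) * (joukowski y - joukowski (p^2)) +
      angle (p * \<beta>) * angle (p * \<gamma>) * angle (p * \<delta>))"
    by (subst four_parameter_symmetrisation) (use y nonzero in \<open>auto simp: p_def\<close>)
  also have "joukowski (p^2) = node n"
    by (simp add: p_def node_def power_mult_distrib flip: power_mult) (simp add: mult.commute)
  also have "u * N * (angle (p * \<beta> * \<gamma> * \<delta>) * (joukowski y - node n) +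
      angle (p * \<beta>) * angle (p * \<gamma>) * angle (p * \<delta>)) =
     u * angle (p * \<beta> * \<gamma> * \<delta>) * newton k (joukowski y) +
     u * (angle (p * \<beta>) * angle (p * \<gamma>) * angle (p * \<delta>)) * newton (k - 1) (joukowski y)"
    by (simp add: Suc newton_Suc N_def algebra_simps)
  also have "u * angle (p * \<beta> * \<gamma> * \<delta>) = diag_coeff k"
    using nonzero by (simp add: diag_coeff_def u_def p_def Suc mult_ac)
  also have "u * (angle (p * \<beta>) * angle (p * \<gamma>) * angle (p * \<delta>)) = lower_coeff k"
    using nonzero by (simp add: lower_coeff_def u_def p_def Suc mult_ac)
  finally show ?thesis .
qed

end

section \<open>The Koornwinder operator on interpolation polynomials\<close>

context koornwinder_parameters begin

definition A_plus :: "nat \<Rightarrow> nat \<Rightarrow> (nat \<Rightarrow> 'a) \<Rightarrow> 'a" where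
  "A_plus m i z =
     ((1 - \<alpha>^2 * z i) * (1 - \<beta>^2 * z i) * (1 - \<gamma>^2 * z i) * (1 - \<delta>^2 * z i)) /
      ((\<alpha> * \<beta> * \<gamma> * \<delta> / \<rho>) * (\<tau>^2) ^ (m - 1) * (1 - z i ^ 2) * (1 - \<rho>^2 * z i ^ 2)) *
      (\<Prod>j\<in>{1..m} - {i}.
        ((1 - \<tau>^2 * z i * z j) * (1 - \<tau>^2 * z i * inverse (z j))) /
        ((1 - z i * z j) * (1 - z i * inverse (z j))))"

text \<open>Koornwinder's operator on functions of the variables \<open>x\<^sub>i = z\<^sub>i + 1/z\<^sub>i\<close>; a shift of \<open>z\<^sub>i\<close>
  changes the value of \<open>x\<^sub>i\<close> alone.\<close>

definition difference_op :: "nat \<Rightarrow> (nat \<Rightarrow> 'a) \<Rightarrow> ((nat \<Rightarrow> 'a) \<Rightarrow> 'a) \<Rightarrow> 'a" where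
  "difference_op m z F = (let x = (\<lambda>i. joukowski (z i)) in
     (\<Sum>i=1..m. A_plus m i z * (F (x(i := joukowski (\<rho>^2 * z i))) - F x)) +
     (\<Sum>i=1..m. A_plus m i (\<lambda>j. inverse (z j)) *
         (F (x(i := joukowski (inverse (\<rho>^2) * z i))) - F x)))"

text \<open>The conditions under which no denominator in the computation vanishes and the \<open>x\<^sub>i\<close> can
  serve as interpolation points.\<close>

definition generic_point :: "nat \<Rightarrow> (nat \<Rightarrow> 'a) \<Rightarrow> bool" where
  "generic_point m z \<longleftrightarrow>
     (\<forall>i\<in>{1..m}. z i \<noteq> 0 \<and> z i ^ 2 \<noteq> 1 \<and> \<tau>^2 * z i ^ 2 \<noteq> 1 \<and> z i ^ 2 \<noteq> \<tau>^2 \<and>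
        \<rho>^2 * z i ^ 2 \<noteq> 1 \<and> z i ^ 2 \<noteq> \<rho>^2) \<and>
     inj_on (\<lambda>i. joukowski (z i)) {1..m}"

lemma generic_point_inverse:
  assumes "generic_point m z"
  shows "generic_point m (\<lambda>j. inverse (z j))"
  using assms unfolding generic_point_def joukowski_inverse
  by (auto simp: field_simps)

text \<open>On functions of degree one in each \<open>x\<^sub>i\<close> the coefficient of the operator meets only the
  increment of \<open>x\<^sub>i\<close>. This increment contains the factor \<open>1 - q z\<^sub>i\<^sup>2\<close>, so that \<open>q\<close> survives only
  as the overall factor \<open>\<langle>q\<rangle>\<close>.\<close>

lemma A_plus_times_increment:
  assumes z: "generic_point m z" and i: "i \<in> {1..m}"
  shows "A_plus m i z * (joukowski (\<rho>^2 * z i) - joukowski (z i)) =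
    angle \<rho> * \<Phi> (z i) *
      (\<Prod>j\<in>{1..m} - {i}. (joukowski (\<tau>^2 * z i) - joukowski (z j)) /
          (joukowski (z i) - joukowski (z j)))"
proof -
  have zi: "z i \<noteq> 0" "z i ^ 2 \<noteq> 1" "\<rho>^2 * z i ^ 2 \<noteq> 1"
    using z i by (auto simp: generic_point_def)
  have quadratic: "(1 - u * v) * (1 - u * inverse v) = u * (joukowski u - joukowski v)"
    if "u \<noteq> 0" "v \<noteq> 0" for u v
    using that by (simp add: joukowski_def field_simps)
  have "(\<Prod>j\<in>{1..m} - {i}.
        ((1 - \<tau>^2 * z i * z j) * (1 - \<tau>^2 * z i * inverse (z j))) /
        ((1 - z i * z j) * (1 - z i * inverse (z j)))) =
     (\<Prod>j\<in>{1..m} - {i}. \<tau>^2 *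
        ((joukowski (\<tau>^2 * z i) - joukowski (z j)) / (joukowski (z i) - joukowski (z j))))"
    using z zi nonzero by (intro prod.cong) (auto simp: quadratic generic_point_def)
  also have "\<dots> = (\<tau>^2) ^ (m - 1) *
      (\<Prod>j\<in>{1..m} - {i}. (joukowski (\<tau>^2 * z i) - joukowski (z j)) /
          (joukowski (z i) - joukowski (z j)))"
    using i by (simp only: prod.distrib) simp
  finally have product: "(\<Prod>j\<in>{1..m} - {i}.
        ((1 - \<tau>^2 * z i * z j) * (1 - \<tau>^2 * z i * inverse (z j))) /
        ((1 - z i * z j) * (1 - z i * inverse (z j)))) = \<dots>" .
  define N where "N = (1 - \<alpha>^2 * z i) * (1 - \<beta>^2 * z i) * (1 - \<gamma>^2 * z i) * (1 - \<delta>^2 * z i)"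
  define S where "S = \<alpha> * \<beta> * \<gamma> * \<delta>"
  have S: "S \<noteq> 0" using nonzero by (simp add: S_def)
  have prefactor: "N / ((S / \<rho>) * (1 - z i ^ 2) * (1 - \<rho>^2 * z i ^ 2)) *
      (joukowski (\<rho>^2 * z i) - joukowski (z i)) =
      angle \<rho> * (N / (S * z i ^ 2 * (z i - inverse (z i))))"
  proof -
    have "joukowski (\<rho>^2 * z i) - joukowski (z i) = (\<rho>^2 - 1) * (\<rho>^2 * z i ^ 2 - 1) / (\<rho>^2 * z i)"
      using joukowski_scale_diff [of "\<rho>^2" "z i"] zi nonzero by simp
    moreover have "z i - inverse (z i) = (z i ^ 2 - 1) / z i"
      using zi by (simp add: field_simps power2_eq_square)
    moreover have "N / (S / \<rho> * - e * - f) * (g * f / (\<rho>^2 * z i)) = g / \<rho> *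
        (N / (S * z i ^ 2 * (e / z i)))"
      if "e \<noteq> 0" "f \<noteq> 0" for e f g
      using that zi nonzero S by (simp add: field_simps power2_eq_square)
    from this [of "z i ^ 2 - 1" "\<rho>^2 * z i ^ 2 - 1" "\<rho>^2 - 1"]
    have "N / (S / \<rho> * (1 - z i ^ 2) * (1 - \<rho>^2 * z i ^ 2)) *
        ((\<rho>^2 - 1) * (\<rho>^2 * z i ^ 2 - 1) / (\<rho>^2 * z i)) =
        (\<rho>^2 - 1) / \<rho> * (N / (S * z i ^ 2 * ((z i ^ 2 - 1) / z i)))"
      using zi by simp
    ultimately show ?thesis
      by (simp only: angle_eq [OF nonzero(5)])
  qed
  have cancel: "N / (S / \<rho> * T * e * f) * (T * R) * j = N / (S / \<rho> * e * f) * j * R" if "T \<noteq> 0"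
      for T R e f j
    using that by (simp add: mult_ac)
  have "(\<tau>^2) ^ (m - 1) \<noteq> 0" using nonzero by simp
  then show ?thesis
    unfolding A_plus_def product \<Phi>_def N_def [symmetric] S_def [symmetric]
        by (simp only: cancel prefactor not_False_eq_True)
qed

abbreviation E :: "nat \<Rightarrow> nat \<Rightarrow> (nat \<Rightarrow> 'a) \<Rightarrow> 'a" where
  "E m s x \<equiv> interp_esym node x m s"

lemma prod_linear_update:
  fixes x :: "nat \<Rightarrow> 'a"
  assumes "i \<in> {1..m}"
  shows "(\<Prod>j=1..m. [:- (x(i := v)) j, 1:]) - (\<Prod>j=1..m. [:- x j, 1:]) =
    smult (x i - v) (\<Prod>j\<in>{1..m} - {i}. [:- x j, 1:])"
proof -
  have "(\<Prod>j\<in>{1..m} - {i}. [:- (x(i := v)) j, 1:]) = (\<Prod>j\<in>{1..m} - {i}. [:- x j, 1:])"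
    by (intro prod.cong) auto
  then have "(\<Prod>j=1..m. [:- (x(i := v)) j, 1:]) = [:- v, 1:] * (\<Prod>j\<in>{1..m} - {i}. [:- x j, 1:])"
    using assms by (subst prod.remove [of _ i]) (auto simp del: mult_pCons_left)
  moreover have "(\<Prod>j=1..m. [:- x j, 1:]) = [:- x i, 1:] * (\<Prod>j\<in>{1..m} - {i}. [:- x j, 1:])"
    using assms by (subst prod.remove [of _ i]) (auto simp del: mult_pCons_left)
  moreover have "[:- v, 1:] - [:- x i, 1:] = [:x i - v:]" by simp
  ultimately show ?thesis
    by (simp only: left_diff_distrib [symmetric]) simp
qed

lemma poly_prod_linear_newton:
  "(\<Prod>j=1..m. v - x j) = (\<Sum>s\<le>m. (-1) ^ s * E m s x * newton (m - s) v)"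
  using arg_cong [OF prod_linear_newton_expansion [of x m node], of "\<lambda>p. poly p v"]
  by (simp add: poly_prod poly_sum newton_def)

text \<open>Linearity, stated for polynomial-valued combinations so that the operator can be applied to
  a generating function coefficientwise.\<close>

lemma difference_op_linear:
  fixes z :: "nat \<Rightarrow> 'a"
  defines "x \<equiv> \<lambda>i. joukowski (z i)"
  shows "(\<Sum>s\<le>m. smult (c s * difference_op n z (F s)) (p s)) =
    (\<Sum>i=1..n. smult (A_plus n i z)
      (\<Sum>s\<le>m. smult (c s * (F s (x(i := joukowski (\<rho>^2 * z i))) - F s x)) (p s))) +
    (\<Sum>i=1..n. smult (A_plus n i (\<lambda>j. inverse (z j)))
      (\<Sum>s\<le>m. smult (c s * (F s (x(i := joukowski (inverse (\<rho>^2) * z i))) - F s x)) (p s)))"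
proof -
  have swap: "(\<Sum>s\<le>m. smult (c s * (\<Sum>i=1..n. B i * G s i)) (p s)) =
      (\<Sum>i=1..n. smult (B i) (\<Sum>s\<le>m. smult (c s * G s i) (p s)))" for B G
    by (subst smult_sum_right, subst sum.swap)
      (intro sum.cong refl, simp add: smult_sum sum_distrib_left mult_ac)
  show ?thesis
    unfolding difference_op_def Let_def x_def [symmetric]
    by (simp only: distrib_left smult_add_left sum.distrib swap)
qed

text \<open>The generating function has degree one in \<open>x\<^sub>i\<close>, so shifting \<open>z\<^sub>i\<close> adds a multiple of the
  product of the other linear factors.\<close>

lemma difference_op_generating_function:
  fixes z :: "nat \<Rightarrow> 'a"
  defines "x \<equiv> \<lambda>i. joukowski (z i)"
  shows "(\<Sum>s\<le>m. smult ((-1) ^ s * difference_op m z (E m s)) (newton_basis node (m - s))) =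
    - (\<Sum>i=1..m. smult (A_plus m i z * (joukowski (\<rho>^2 * z i) - x i) +
        A_plus m i (\<lambda>j. inverse (z j)) * (joukowski (inverse (\<rho>^2) * z i) - x i))
      (\<Prod>j\<in>{1..m} - {i}. [:- x j, 1:]))"
proof -
  have "(\<Sum>s\<le>m. smult ((-1) ^ s * (E m s (x(i := v)) - E m s x)) (newton_basis node (m - s))) =
      - smult (v - x i) (\<Prod>j\<in>{1..m} - {i}. [:- x j, 1:])" if "i \<in> {1..m}" for i v
    using prod_linear_update [OF that, of x v]
    unfolding prod_linear_newton_expansion [where a = node]
    by (simp add: right_diff_distrib smult_diff_left sum_subtractf del: fun_upd_apply)
  then show ?thesis
    unfolding difference_op_linear x_def [symmetric]
    by (simp add: sum_negf sum.distrib smult_add_left)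
qed

text \<open>Both sides have degree less than \<open>m\<close> in \<open>y\<close>; on the right the coefficient of \<open>N\<^sub>m\<close> is zero.
  So it suffices to compare them at the distinct points \<open>y = x\<^sub>i\<close>. There the left-hand side
  reduces to the \<open>i\<close>-th summand, and the right-hand side, after \<open>Psi_newton_two_term\<close> is read
  backwards, is minus the one-variable operator applied to the generating function. The two agree
  because the generating function itself vanishes at \<open>x\<^sub>i\<close>.\<close>

lemma difference_op_interp_esym_poly:
  fixes z :: "nat \<Rightarrow> 'a"
  defines "x \<equiv> \<lambda>i. joukowski (z i)"
  assumes z: "generic_point m z" and m: "m \<ge> 1"
  shows "(\<Sum>s\<le>m. smult ((-1) ^ s * difference_op m z (E m s)) (newton_basis node (m - s))) =
    smult (angle \<rho>) (\<Sum>s\<le>m. smult ((-1) ^ s * E m s x)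
      (smult (diag_coeff m - diag_coeff (m - s)) (newton_basis node (m - s)) -
       smult (lower_coeff (m - s)) (newton_basis node (m - s - 1))))"
    (is "?L = smult (angle \<rho>) ?R")
proof (rule poly_eqI_degree [where A = "x ` {1..m}"])
  define G where "G i = A_plus m i z * (joukowski (\<rho>^2 * z i) - x i) +
        A_plus m i (\<lambda>j. inverse (z j)) * (joukowski (inverse (\<rho>^2) * z i) - x i)" for i
  have L: "?L = - (\<Sum>i=1..m. smult (G i) (\<Prod>j\<in>{1..m} - {i}. [:- x j, 1:]))"
    unfolding difference_op_generating_function G_def x_def ..
  have inj: "inj_on x {1..m}" using z by (simp add: generic_point_def x_def)
  have card: "card (x ` {1..m}) = m"
    using card_image [OF inj] by simp
  show "degree ?L < card (x ` {1..m})"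
    unfolding L card degree_minus
  proof (rule degree_sum_less)
    fix i assume "i \<in> {1..m}"
    then have "card ({1..m} - {i}) < m" by simp
    moreover have "degree (\<Prod>j\<in>{1..m} - {i}. [:- x j, 1:]) \<le> card ({1..m} - {i})"
      using degree_prod_sum_le [of "{1..m} - {i}" "\<lambda>j. [:- x j, 1:]"] by simp
    ultimately show "degree (smult (G i) (\<Prod>j\<in>{1..m} - {i}. [:- x j, 1:])) < m"
      by (intro order.strict_trans1 [OF degree_smult_le]) (rule order.strict_trans1)
  qed (use m in simp)
  show "degree (smult (angle \<rho>) ?R) < card (x ` {1..m})"
    unfolding card
  proof (rule order.strict_trans1 [OF degree_smult_le degree_sum_less])
    fix s assume "s \<in> {..m}"
    have "degree (smult (diag_coeff m - diag_coeff (m - s)) (newton_basis node (m - s))) < m"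
    proof (cases "s = 0")
      case False
      then show ?thesis
        using m by (intro order.strict_trans1
            [OF order.trans [OF degree_smult_le degree_newton_basis_le]]) simp
    qed (use m in simp)
    moreover have "degree (smult (lower_coeff (m - s)) (newton_basis node (m - s - 1))) \<le> m - s - 1"
      by (rule order.trans [OF degree_smult_le degree_newton_basis_le])
    then have "degree (smult (lower_coeff (m - s)) (newton_basis node (m - s - 1))) < m"
      using m by simp
    ultimately show "degree (smult ((-1) ^ s * E m s x)
      (smult (diag_coeff m - diag_coeff (m - s)) (newton_basis node (m - s)) -
       smult (lower_coeff (m - s)) (newton_basis node (m - s - 1)))) < m"
      by (intro order.strict_trans1 [OF degree_smult_le degree_diff_less])
  qed (use m in simp)
  fix v assume "v \<in> x ` {1..m}"
  then obtain i where i: "i \<in> {1..m}" and v: "v = x i" by auto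
  define y where "y = z i"
  have y: "y \<noteq> 0" "y ^ 2 \<noteq> 1" "\<tau>^2 * y ^ 2 \<noteq> 1" "y ^ 2 \<noteq> \<tau>^2"
    using z i by (auto simp: generic_point_def y_def)
  have vy: "v = joukowski y" "joukowski y = x i" by (simp_all add: v x_def y_def)
  have nz: "x i - x j \<noteq> 0" if "j \<in> {1..m} - {i}" for j
    using inj i that by (auto dest: inj_onD)
  let ?D = "\<Prod>j\<in>{1..m} - {i}. x i - x j"
  have Dnz: "?D \<noteq> 0" using nz by auto
  \<comment> \<open>The missing factor \<open>j = i\<close> of the product over \<open>j\<close> turns \<open>\<Phi>\<close> into \<open>\<Psi>\<close>. The fact is used for
    \<open>z\<close> and for the inverted point, which has the same \<open>x\<^sub>j\<close>.\<close>
  have inc: "A_plus m i w * (joukowski (\<rho>^2 * w i) - x i) * ?D = angle \<rho> *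
      (\<Psi> (w i) * (\<Prod>j=1..m. joukowski (\<tau>^2 * w i) - x j))"
    if w: "generic_point m w" and wx: "\<And>j. joukowski (w j) = x j" for w
  proof -
    have 0: "A_plus m i w * (joukowski (\<rho>^2 * w i) - x i) =
        angle \<rho> * \<Phi> (w i) * (\<Prod>j\<in>{1..m} - {i}. (joukowski (\<tau>^2 * w i) - x j) / (x i - x j))"
      using A_plus_times_increment [OF w i] by (simp add: wx)
    have 1: "(\<Prod>j\<in>{1..m} - {i}. (joukowski (\<tau>^2 * w i) - x j) / (x i - x j)) * ?D =
        (\<Prod>j\<in>{1..m} - {i}. joukowski (\<tau>^2 * w i) - x j)"
      using Dnz by (simp add: prod_dividef)
    have wi: "w i \<noteq> 0" "\<tau>^2 * w i ^ 2 \<noteq> 1"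
      using w i by (auto simp: generic_point_def)
    have "joukowski (\<tau>^2 * w i) - x i = (\<tau>^2 - 1) * (\<tau>^2 * w i ^ 2 - 1) / (\<tau>^2 * w i)"
      using joukowski_scale_diff [of "\<tau>^2" "w i"] wi nonzero by (simp add: wx)
    also have "\<dots> \<noteq> 0" using wi nonzero t_neq_1 by simp
    finally have "joukowski (\<tau>^2 * w i) - x i \<noteq> 0" .
    then have "\<Phi> (w i) = \<Psi> (w i) * (joukowski (\<tau>^2 * w i) - x i)"
      by (simp add: \<Psi>_def wx)
    then have "\<Phi> (w i) * (\<Prod>j\<in>{1..m} - {i}. joukowski (\<tau>^2 * w i) - x j) =
        \<Psi> (w i) * (\<Prod>j=1..m. joukowski (\<tau>^2 * w i) - x j)"
      using prod.remove [of "{1..m}" i "\<lambda>j. joukowski (\<tau>^2 * w i) - x j"] i by simp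
    then show ?thesis
      unfolding 0 mult.assoc 1 by (rule arg_cong)
  qed
  have "poly ?L v = - (G i * ?D)"
  proof -
    have "(\<Sum>k=1..m. G k * (\<Prod>j\<in>{1..m} - {k}. x i - x j)) =
        (\<Sum>k\<in>{i}. G k * (\<Prod>j\<in>{1..m} - {k}. x i - x j))"
      using i by (intro sum.mono_neutral_right) auto
    then show ?thesis
      unfolding L by (simp add: poly_sum poly_prod v)
  qed
  also have "G i * ?D = angle \<rho> * (\<Psi> y * (\<Prod>j=1..m. joukowski (\<tau>^2 * y) - x j) +
      \<Psi> (inverse y) * (\<Prod>j=1..m. joukowski (\<tau>^2 * inverse y) - x j))"
    using inc [OF z] inc [OF generic_point_inverse [OF z]]
      joukowski_inverse [of "\<rho>^2 * inverse y"]
    by (simp add: G_def distrib_right distrib_left x_def y_def)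
  also have "- \<dots> = angle \<rho> * - (\<Psi> y * (\<Prod>j=1..m. joukowski (\<tau>^2 * y) - x j) +
      \<Psi> (inverse y) * (\<Prod>j=1..m. joukowski (\<tau>^2 * inverse y) - x j))"
    by (rule mult_minus_right [symmetric])
  also have "- (\<Psi> y * (\<Prod>j=1..m. joukowski (\<tau>^2 * y) - x j) +
      \<Psi> (inverse y) * (\<Prod>j=1..m. joukowski (\<tau>^2 * inverse y) - x j)) = poly ?R v"
  proof -
    have 0: "(\<Prod>j=1..m. v - x j) = 0" using i v by auto
    have "(\<Sum>s\<le>m. (-1) ^ s * E m s x *
        (diag_coeff (m - s) * newton (m - s) v + lower_coeff (m - s) * newton (m - s - 1) v)) =
      (\<Sum>s\<le>m. (-1) ^ s * E m s x *
       (\<Psi> y * (newton (m - s) (joukowski (\<tau>^2 * y)) - newton (m - s) v) +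
        \<Psi> (inverse y) * (newton (m - s) (joukowski (\<tau>^2 * inverse y)) - newton (m - s) v)))"
      unfolding vy(1) Psi_newton_two_term [OF y] ..
    also have "\<dots> = \<Psi> y * ((\<Prod>j=1..m. joukowski (\<tau>^2 * y) - x j) - (\<Prod>j=1..m. v - x j)) +
        \<Psi> (inverse y) * ((\<Prod>j=1..m. joukowski (\<tau>^2 * inverse y) - x j) - (\<Prod>j=1..m. v - x j))"
      unfolding poly_prod_linear_newton sum_distrib_left sum_subtractf [symmetric] sum.distrib
          [symmetric]
      by (intro sum.cong refl) (simp only: algebra_simps)
    finally have 1: "(\<Sum>s\<le>m. (-1) ^ s * E m s x *
        (diag_coeff (m - s) * newton (m - s) v + lower_coeff (m - s) * newton (m - s - 1) v)) =
        \<Psi> y * (\<Prod>j=1..m. joukowski (\<tau>^2 * y) - x j) +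
        \<Psi> (inverse y) * (\<Prod>j=1..m. joukowski (\<tau>^2 * inverse y) - x j)"
      unfolding 0 by simp
    have "poly ?R v = diag_coeff m * (\<Prod>j=1..m. v - x j) - (\<Sum>s\<le>m. (-1) ^ s * E m s x *
        (diag_coeff (m - s) * newton (m - s) v + lower_coeff (m - s) * newton (m - s - 1) v))"
      unfolding poly_prod_linear_newton sum_distrib_left sum_subtractf [symmetric] poly_sum
      by (intro sum.cong refl) (simp add: newton_def algebra_simps)
    then show ?thesis unfolding 0 1 by simp
  qed
  finally show "poly ?L v = poly (smult (angle \<rho>) ?R) v" by simp
qed

theorem difference_op_interp_esym:
  fixes z :: "nat \<Rightarrow> 'a"
  defines "x \<equiv> \<lambda>i. joukowski (z i)"
  assumes z: "generic_point m z" and m: "m \<ge> 1" and s: "s \<le> m"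
  shows "difference_op m z (E m s) = angle \<rho> * ((diag_coeff m - diag_coeff (m - s)) * E m s x +
     (if s = 0 then 0 else lower_coeff (m - (s - 1)) * E m (s - 1) x))"
proof -
  obtain n where n: "m = Suc n" using m by (cases m) auto
  have lc0: "lower_coeff 0 = 0" by (simp add: lower_coeff_def angle_def)
  let ?N = "newton_basis node"
  let ?l = "\<lambda>s. if s = 0 then 0 else lower_coeff (m - (s - 1)) * E m (s - 1) x"
  have "(\<Sum>s\<le>m. smult ((-1) ^ s * E m s x) (smult (lower_coeff (m - s)) (?N (m - s - 1)))) =
      (\<Sum>s\<le>n. smult ((-1) ^ s * E m s x) (smult (lower_coeff (m - s)) (?N (m - s - 1))))"
    by (simp add: n lc0)
  also have "\<dots> = (\<Sum>s\<le>n. - smult ((-1) ^ Suc s * ?l (Suc s)) (?N (m - Suc s)))"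
    by (intro sum.cong refl) (simp add: mult_ac)
  also have "\<dots> = - (\<Sum>s\<le>m. smult ((-1) ^ s * ?l s) (?N (m - s)))"
    unfolding n sum.atMost_Suc_shift by (simp add: sum_negf)
  finally have lower: "(\<Sum>s\<le>m. smult ((-1) ^ s *
      E m s x) (smult (lower_coeff (m - s)) (?N (m - s - 1)))) = \<dots>" .
  have "(\<Sum>s\<le>m. smult ((-1) ^ s * difference_op m z (E m s)) (?N (m - s))) =
    smult (angle \<rho>) ((\<Sum>s\<le>m. smult ((-1) ^ s *
        E m s x) (smult (diag_coeff m - diag_coeff (m - s)) (?N (m - s)))) -
      (\<Sum>s\<le>m. smult ((-1) ^ s * E m s x) (smult (lower_coeff (m - s)) (?N (m - s - 1)))))"
    unfolding difference_op_interp_esym_poly [OF z m] x_def sum_subtractf [symmetric]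
        smult_diff_right ..
  also have "\<dots> = (\<Sum>s\<le>m. smult ((-1) ^ s *
      (angle \<rho> * ((diag_coeff m - diag_coeff (m - s)) * E m s x + ?l s))) (?N (m - s)))"
    unfolding lower diff_minus_eq_add sum.distrib [symmetric] smult_sum_right
    by (intro sum.cong refl) (simp add: smult_add_left smult_add_right distrib_left mult_ac)
  finally have "(-1) ^ s * difference_op m z (E m s) =
      (-1) ^ s * (angle \<rho> * ((diag_coeff m - diag_coeff (m - s)) * E m s x + ?l s))"
    by (rule newton_coeffs_unique [OF _ s])
  then show ?thesis by simp
qed

end

section \<open>Substitution in Laurent polynomials\<close>

interpretation to_fract_hom: ring_hom "to_fract :: 'a::idom \<Rightarrow> 'a fract"
  by unfold_locales simp_all

interpretation lconst_hom: ring_hom lconst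
  by unfold_locales (simp_all add: lconst_def single_add mult_single)

lemma lvar_pow_inverse: "lvar_pow i e * lvar_pow i (- e) = 1"
  by (simp add: lvar_pow_def mult_single single_add [symmetric])

lemma zvar_nonzero [simp]: "zvar i \<noteq> 0"
  using arg_cong [OF lvar_pow_inverse [of i 1], of to_fract]
      by (auto simp: zvar_def simp del: to_fract_eq_0_iff)

lemma to_fract_lvar_pow: "to_fract (lvar_pow i (- 1)) = inverse (zvar i)"
  using arg_cong [OF lvar_pow_inverse [of i 1], of to_fract]
  by (intro inverse_unique [symmetric]) (simp add: zvar_def)

definition monomial_value :: "(nat \<Rightarrow> ratfun) \<Rightarrow> (nat \<Rightarrow>\<^sub>0 int) \<Rightarrow> ratfun" where
  "monomial_value f \<nu> = (\<Prod>i\<in>Poly_Mapping.keys \<nu>. f i powi Poly_Mapping.lookup \<nu> i)"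

lemma monomial_value_superset:
  assumes "finite S" "Poly_Mapping.keys \<nu> \<subseteq> S"
  shows "monomial_value f \<nu> = (\<Prod>i\<in>S. f i powi Poly_Mapping.lookup \<nu> i)"
  unfolding monomial_value_def using assms
  by (intro prod.mono_neutral_left) (auto simp: in_keys_iff)

lemma monomial_value_add:
  assumes "\<And>i. f i \<noteq> 0"
  shows "monomial_value f (\<mu> + \<nu>) = monomial_value f \<mu> * monomial_value f \<nu>"
proof -
  let ?S = "Poly_Mapping.keys \<mu> \<union> Poly_Mapping.keys \<nu>"
  have "Poly_Mapping.keys (\<mu> + \<nu>) \<subseteq> ?S" by (rule Poly_Mapping.keys_add)
  then show ?thesis
    using assms by (simp add: monomial_value_superset [of ?S] lookup_add power_int_add prod.distrib)
qed

lemma lsubst_superset: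
  assumes "finite S" "Poly_Mapping.keys P \<subseteq> S"
  shows "lsubst f P = (\<Sum>\<nu>\<in>S. to_fract (lconst (Poly_Mapping.lookup P \<nu>)) * monomial_value f \<nu>)"
  unfolding lsubst_def monomial_value_def [symmetric] using assms
  by (intro sum.mono_neutral_left) (auto simp: in_keys_iff lconst_hom.hom_0)

lemma lsubst_single: "lsubst f (Poly_Mapping.single \<nu> c) = to_fract (lconst c) * monomial_value f \<nu>"
  by (subst lsubst_superset [of "{\<nu>}"]) auto

lemma lsubst_add: "lsubst f (P + Q) = lsubst f P + lsubst f Q"
proof -
  let ?S = "Poly_Mapping.keys P \<union> Poly_Mapping.keys Q"
  have "Poly_Mapping.keys (P + Q) \<subseteq> ?S" by (rule Poly_Mapping.keys_add)
  then show ?thesis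
    by (simp add: lsubst_superset [of ?S] lookup_add lconst_hom.hom_add distrib_right sum.distrib)
qed

lemma lsubst_sum: "lsubst f (sum P A) = (\<Sum>i\<in>A. lsubst f (P i))"
  by (induction A rule: infinite_finite_induct) (simp_all add: lsubst_add, simp_all add: lsubst_def)

lemma laurent_decompose:
  "P = (\<Sum>\<nu>\<in>Poly_Mapping.keys P. Poly_Mapping.single \<nu> (Poly_Mapping.lookup P \<nu>))"
proof (rule poly_mapping_eqI)
  fix \<mu>
  show "Poly_Mapping.lookup P \<mu> =
      Poly_Mapping.lookup (\<Sum>\<nu>\<in>Poly_Mapping.keys P. Poly_Mapping.single \<nu>
          (Poly_Mapping.lookup P \<nu>)) \<mu>"
    by (cases "\<mu> \<in> Poly_Mapping.keys P")
      (auto simp: lookup_sum lookup_single when_def in_keys_iff sum.delta)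
qed

text \<open>It suffices to check this on monomials; there it is the exponent law for integer powers,
  which needs nonzero bases.\<close>

lemma lsubst_mult:
  assumes "\<And>i. f i \<noteq> 0"
  shows "lsubst f (P * Q) = lsubst f P * lsubst f Q"
proof -
  have "P * Q = (\<Sum>\<mu>\<in>Poly_Mapping.keys P. \<Sum>\<nu>\<in>Poly_Mapping.keys Q.
      Poly_Mapping.single (\<mu> + \<nu>) (Poly_Mapping.lookup P \<mu> * Poly_Mapping.lookup Q \<nu>))"
    by (subst laurent_decompose [of P], subst laurent_decompose [of Q])
      (simp only: sum_product mult_single)
  also have "lsubst f \<dots> = lsubst f P * lsubst f Q"
    by (simp add: lsubst_sum lsubst_single monomial_value_add [OF assms] lconst_hom.hom_mult)
      (simp add: lsubst_def monomial_value_def [symmetric] sum_product mult_ac)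
  finally show ?thesis .
qed

lemma ring_hom_lsubst:
  assumes "\<And>i. f i \<noteq> 0"
  shows "ring_hom (lsubst f)"
proof
  show "lsubst f 1 = 1"
    using lsubst_single [of f 0 1] by (simp add: monomial_value_def lconst_hom.hom_1)
qed (simp_all add: lsubst_add lsubst_mult assms)

lemma lsubst_lconst: "lsubst f (lconst c) = to_fract (lconst c)"
  using lsubst_single [of f 0 c] by (simp add: monomial_value_def lconst_def)

lemma lsubst_lvar_pow: "lsubst f (lvar_pow i e) = f i powi e"
  unfolding lvar_pow_def lsubst_single
  by (subst monomial_value_superset [of "{i}"]) (simp_all add: lconst_hom.hom_1)

section \<open>Orbit sums of columns\<close>

definition sym_var :: "nat \<Rightarrow> laurent" where
  "sym_var i = lvar_pow i 1 + lvar_pow i (- 1)"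

definition sign_exponents :: "nat \<Rightarrow> nat \<Rightarrow> (nat \<Rightarrow>\<^sub>0 int) set" where
  "sign_exponents m s = {\<nu>. Poly_Mapping.keys \<nu> \<subseteq> {1..m} \<and>
     (\<forall>i. Poly_Mapping.lookup \<nu> i \<in> {-1, 0, 1}) \<and> card (Poly_Mapping.keys \<nu>) = s}"

text \<open>An exponent vector of this shape lies in the orbit because a bijection from its support to
  \<open>{1..s}\<close> and one between the complements glue to a permutation; the signs are read off from its
  entries.\<close>

lemma W_orbit_column:
  assumes "s \<le> m"
  shows "W_orbit m (column s) = sign_exponents m s"
proof (intro equalityI subsetI)
  fix \<nu> assume "\<nu> \<in> W_orbit m (column s)"
  then obtain \<sigma> \<epsilon> where \<sigma>: "\<sigma> permutes {1..m}" and \<epsilon>: "sign_vector m \<epsilon>"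
    and \<nu>: "\<And>i. Poly_Mapping.lookup \<nu> i = (if i \<in> {1..m} then \<epsilon> i * int (column s (\<sigma> i)) else 0)"
    by (auto simp: W_orbit_def)
  have \<epsilon>': "\<epsilon> i = 1 \<or> \<epsilon> i = -1" if "i \<in> {1..m}" for i
    using \<epsilon> that by (auto simp: sign_vector_def)
  have "Poly_Mapping.keys \<nu> = {i \<in> {1..m}. \<sigma> i \<in> {1..s}}"
    using \<epsilon>' by (force simp: in_keys_iff \<nu> column_def sign_vector_def split: if_splits)
  also have "\<dots> = inv \<sigma> ` {1..s}"
  proof (intro equalityI subsetI)
    fix i assume "i \<in> {i \<in> {1..m}. \<sigma> i \<in> {1..s}}"
    then show "i \<in> inv \<sigma> ` {1..s}"
      using permutes_inverses(2) [OF \<sigma>, of i]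
          by (metis (mono_tags, lifting) image_eqI mem_Collect_eq)
  next
    fix i assume "i \<in> inv \<sigma> ` {1..s}"
    then obtain k where k: "k \<in> {1..s}" "i = inv \<sigma> k" by auto
    then have "\<sigma> i = k" using permutes_inverses(1) [OF \<sigma>] by simp
    moreover have "i \<in> {1..m}"
      using k assms permutes_in_image [OF permutes_inv [OF \<sigma>], of k] by auto
    ultimately show "i \<in> {i \<in> {1..m}. \<sigma> i \<in> {1..s}}" using k by simp
  qed
  finally have keys: "Poly_Mapping.keys \<nu> = inv \<sigma> ` {1..s}" .
  have "card (Poly_Mapping.keys \<nu>) = s"
    unfolding keys using card_image [of "inv \<sigma>" "{1..s}"] permutes_inj_on [OF permutes_inv [OF \<sigma>]]
        by simp
  then show "\<nu> \<in> sign_exponents m s"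
    using \<epsilon> by (auto simp: sign_exponents_def in_keys_iff \<nu> column_def sign_vector_def split:
        if_splits)
next
  fix \<nu> assume \<nu>: "\<nu> \<in> sign_exponents m s"
  let ?K = "Poly_Mapping.keys \<nu>"
  have K: "?K \<subseteq> {1..m}" "card ?K = s" using \<nu> by (auto simp: sign_exponents_def)
  obtain f where f: "bij_betw f ?K {1..s}"
    using finite_same_card_bij [of ?K "{1..s}"] K by auto
  have "card ({1..m} - ?K) = card {Suc s..m}"
    using K by (simp add: card_Diff_subset)
  then obtain g where g: "bij_betw g ({1..m} - ?K) {Suc s..m}"
    using finite_same_card_bij [of "{1..m} - ?K" "{Suc s..m}"] by auto
  define \<sigma> where "\<sigma> i = (if i \<in> ?K then f i else if i \<in> {1..m} then g i else i)" for i
  have "bij_betw \<sigma> (?K \<union> ({1..m} - ?K)) ({1..s} \<union> {Suc s..m})"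
  proof (rule bij_betw_combine)
    show "bij_betw \<sigma> ?K {1..s}"
      using f by (rule bij_betw_cong [THEN iffD1, rotated]) (simp add: \<sigma>_def)
    show "bij_betw \<sigma> ({1..m} - ?K) {Suc s..m}"
      using g by (rule bij_betw_cong [THEN iffD1, rotated]) (simp add: \<sigma>_def)
  qed auto
  moreover have "?K \<union> ({1..m} - ?K) = {1..m}" using K by auto
  moreover have "{1..s} \<union> {Suc s..m} = {1..m}" using assms by auto
  ultimately have "bij_betw \<sigma> {1..m} {1..m}" by simp
  then have \<sigma>: "\<sigma> permutes {1..m}"
    using K by (intro bij_imp_permutes) (auto simp: \<sigma>_def)
  have col: "column s (\<sigma> i) = (if i \<in> ?K then 1 else 0)" if "i \<in> {1..m}" for i
  proof (cases "i \<in> ?K")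
    case True
    then show ?thesis using bij_betwE [OF f] by (simp add: \<sigma>_def column_def)
  next
    case False
    then have "g i \<in> {Suc s..m}" using bij_betwE [OF g] that by blast
    then show ?thesis using False that by (simp add: \<sigma>_def column_def)
  qed
  define \<epsilon> where "\<epsilon> i = (if Poly_Mapping.lookup \<nu> i = -1 then -1 else 1 :: int)" for i
  have "sign_vector m \<epsilon>" by (auto simp: sign_vector_def \<epsilon>_def)
  moreover have "Poly_Mapping.lookup \<nu> i = (if i \<in> {1..m} then \<epsilon> i * int (column s (\<sigma> i)) else 0)"
      for i
  proof (cases "i \<in> {1..m}")
    case True
    have "Poly_Mapping.lookup \<nu> i \<in> {-1, 0, 1}" using \<nu> by (auto simp: sign_exponents_def)
    then show ?thesis using col [OF True] True by (auto simp: \<epsilon>_def in_keys_iff)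
  qed (use K in \<open>auto simp: in_keys_iff\<close>)
  ultimately show "\<nu> \<in> W_orbit m (column s)"
    unfolding W_orbit_def using \<sigma> by blast
qed

lemma sign_exponents_0: "sign_exponents m 0 = {0}"
  by (auto simp: sign_exponents_def)

lemma sign_exponents_0_Suc: "sign_exponents 0 (Suc s) = {}"
  by (auto simp: sign_exponents_def)

lemma keys_single_add:
  fixes \<nu> :: "nat \<Rightarrow>\<^sub>0 int"
  assumes "k \<notin> Poly_Mapping.keys \<nu>" "e \<noteq> 0"
  shows "Poly_Mapping.keys (Poly_Mapping.single k e + \<nu>) = insert k (Poly_Mapping.keys \<nu>)"
  using assms by (auto simp: in_keys_iff lookup_add lookup_single when_def split: if_splits)

lemma sign_exponents_Suc_Suc:
  "sign_exponents (Suc m) (Suc s) = sign_exponents m (Suc s) \<union>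
     ((+) (Poly_Mapping.single (Suc m) 1) ` sign_exponents m s \<union>
      (+) (Poly_Mapping.single (Suc m) (- 1)) ` sign_exponents m s)"
proof (intro equalityI subsetI)
  fix \<nu> assume \<nu>: "\<nu> \<in> sign_exponents (Suc m) (Suc s)"
  define e where "e = Poly_Mapping.lookup \<nu> (Suc m)"
  have e: "e \<in> {-1, 0, 1}" using \<nu> by (auto simp: sign_exponents_def e_def)
  show "\<nu> \<in> sign_exponents m (Suc s) \<union>
     ((+) (Poly_Mapping.single (Suc m) 1) ` sign_exponents m s \<union>
      (+) (Poly_Mapping.single (Suc m) (- 1)) ` sign_exponents m s)"
  proof (cases "e = 0")
    case True
    then have "Suc m \<notin> Poly_Mapping.keys \<nu>" by (simp add: e_def in_keys_iff)
    then have "\<nu> \<in> sign_exponents m (Suc s)"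
      using \<nu> by (auto simp: sign_exponents_def atLeastAtMostSuc_conv)
    then show ?thesis by simp
  next
    case False
    define \<mu> where "\<mu> = \<nu> - Poly_Mapping.single (Suc m) e"
    have \<nu>\<mu>: "\<nu> = Poly_Mapping.single (Suc m) e + \<mu>" by (simp add: \<mu>_def)
    have look: "Poly_Mapping.lookup \<mu> i = (if i = Suc m then 0 else Poly_Mapping.lookup \<nu> i)" for i
      by (simp add: \<mu>_def lookup_minus lookup_single e_def when_def)
    then have k: "Poly_Mapping.keys \<mu> = Poly_Mapping.keys \<nu> - {Suc m}"
      by (auto simp: in_keys_iff split: if_splits)
    have "Suc m \<in> Poly_Mapping.keys \<nu>" using False by (simp add: e_def in_keys_iff)
    then have "\<mu> \<in> sign_exponents m s"
      using \<nu> k look by (auto simp: sign_exponents_def atLeastAtMostSuc_conv)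
    then show ?thesis using \<nu>\<mu> e False by auto
  qed
next
  fix \<nu> assume "\<nu> \<in> sign_exponents m (Suc s) \<union>
     ((+) (Poly_Mapping.single (Suc m) 1) ` sign_exponents m s \<union>
      (+) (Poly_Mapping.single (Suc m) (- 1)) ` sign_exponents m s)"
  then consider "\<nu> \<in> sign_exponents m (Suc s)"
    | e \<mu> where "e \<in> {1, -1}" "\<mu> \<in> sign_exponents m s" "\<nu> = Poly_Mapping.single (Suc m) e + \<mu>"
    by blast
  then show "\<nu> \<in> sign_exponents (Suc m) (Suc s)"
  proof cases
    case 1
    then show ?thesis by (fastforce simp: sign_exponents_def)
  next
    case 2
    then have n: "Suc m \<notin> Poly_Mapping.keys \<mu>" "e \<noteq> 0" by (auto simp: sign_exponents_def)
    have "Poly_Mapping.lookup \<nu> i = (if i = Suc m then e else Poly_Mapping.lookup \<mu> i)" for i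
      using n(1) by (auto simp: 2(3) lookup_add lookup_single when_def in_keys_iff)
    then show ?thesis
      using 2 keys_single_add [OF n] n by (auto simp: sign_exponents_def)
  qed
qed

lemma finite_sign_exponents: "finite (sign_exponents m s)"
proof (induction m arbitrary: s)
  case 0
  then show ?case by (cases s) (auto simp: sign_exponents_0 sign_exponents_0_Suc)
next
  case (Suc m)
  then show ?case by (cases s) (auto simp: sign_exponents_0 sign_exponents_Suc_Suc)
qed

text \<open>The entry of the exponent vector at \<open>m + 1\<close> is \<open>0\<close>, \<open>1\<close> or \<open>-1\<close>; this is the recursion of
  \<open>interp_esym\<close> for zero nodes and \<open>x\<^sub>m\<^sub>+\<^sub>1 = z\<^sub>m\<^sub>+\<^sub>1 + 1/z\<^sub>m\<^sub>+\<^sub>1\<close>.\<close>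

lemma sum_sign_exponents:
  "(\<Sum>\<nu>\<in>sign_exponents m s. Poly_Mapping.single \<nu> 1) = interp_esym (\<lambda>_. 0) sym_var m s"
proof (induction m arbitrary: s)
  case 0
  then show ?case by (cases s) (auto simp: sign_exponents_0 sign_exponents_0_Suc)
next
  case (Suc m s')
  show ?case
  proof (cases s')
    case 0
    then show ?thesis by (auto simp: sign_exponents_0)
  next
    case (Suc s)
    let ?sh = "\<lambda>e. (+) (Poly_Mapping.single (Suc m) e) ` sign_exponents m s"
    have lk: "Poly_Mapping.lookup \<mu> (Suc m) = 0" if "\<mu> \<in> sign_exponents m s" for \<mu> s
      using that by (auto simp: sign_exponents_def in_keys_iff subset_iff)
    have lk': "Poly_Mapping.lookup \<nu> (Suc m) = e" if "\<nu> \<in> ?sh e" for \<nu> e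
      using that lk by (auto simp: lookup_add)
    have d1: "sign_exponents m (Suc s) \<inter> (?sh 1 \<union> ?sh (- 1)) = {}"
      using lk lk' by (metis (no_types, lifting) Int_emptyI UnE one_neq_zero neg_equal_0_iff_equal)
    have d2: "?sh 1 \<inter> ?sh (- 1) = {}"
      using lk' by (metis (no_types, lifting) Int_emptyI one_neq_neg_one)
    have sh: "(\<Sum>\<nu>\<in>?sh e. Poly_Mapping.single \<nu> (1::coef)) =
        lvar_pow (Suc m) e * interp_esym (\<lambda>_. 0) sym_var m s" for e
    proof -
      have "(\<Sum>\<nu>\<in>?sh e. Poly_Mapping.single \<nu> (1::coef)) =
          (\<Sum>\<nu>\<in>sign_exponents m s. lvar_pow (Suc m) e * Poly_Mapping.single \<nu> 1)"
        by (subst sum.reindex) (auto simp: lvar_pow_def mult_single)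
      then show ?thesis by (simp add: sum_distrib_left [symmetric] Suc.IH)
    qed
    show ?thesis
      unfolding Suc sign_exponents_Suc_Suc
      using d1 d2 finite_sign_exponents Suc.IH [of "Suc s"]
      by (simp add: sum.union_disjoint sh sym_var_def [of "Suc m"] distrib_right)
  qed
qed

lemma orbit_sum_column:
  "s \<le> m \<Longrightarrow> orbit_sum m (column s) = interp_esym (\<lambda>_. 0) sym_var m s"
  by (simp add: orbit_sum_def W_orbit_column sum_sign_exponents)

lemma lookup_lconst_mult: "Poly_Mapping.lookup (lconst c * P) \<nu> = c * Poly_Mapping.lookup P \<nu>"
  by (simp add: lconst_def mult_map_scale_conv_mult [symmetric] Poly_Mapping.map.rep_eq when_def)

text \<open>The monomial \<open>z\<^sub>1 \<cdots> z\<^sub>s\<close> occurs in the orbit sum of \<open>(1\<^sup>s)\<close> and in no other one.\<close>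

lemma orbit_sum_column_independent:
  assumes "(\<Sum>s\<le>r. lconst (v s) * orbit_sum m (column s)) = 0" and "r \<le> m" and "s \<le> r"
  shows "v s = 0"
proof -
  define \<nu> :: "nat \<Rightarrow>\<^sub>0 int" where "\<nu> = (\<Sum>i=1..s. Poly_Mapping.single i 1)"
  have look: "Poly_Mapping.lookup \<nu> i = (if i \<in> {1..s} then 1 else 0)" for i
    by (auto simp: \<nu>_def lookup_sum lookup_single when_def)
  have keys: "Poly_Mapping.keys \<nu> = {1..s}"
    by (auto simp: in_keys_iff look split: if_splits)
  have "Poly_Mapping.lookup (orbit_sum m (column j)) \<nu> = (if j = s then 1 else 0)" if "j \<le> r" for j
  proof -
    have "\<nu> \<in> sign_exponents m j \<longleftrightarrow> j = s"
      using assms by (auto simp: sign_exponents_def keys look)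
    then show ?thesis
      using that assms by (auto
          simp: orbit_sum_def W_orbit_column lookup_sum lookup_single when_def
          finite_sign_exponents)
  qed
  then have "Poly_Mapping.lookup (\<Sum>s\<le>r. lconst (v s) * orbit_sum m (column s)) \<nu> =
      (\<Sum>j\<le>r. v j * (if j = s then 1 else 0))"
    unfolding lookup_sum by (intro sum.cong refl) (simp add: lookup_lconst_mult)
  also have "\<dots> = v s" using assms by (simp add: if_distrib cong: if_cong)
  finally show ?thesis using assms by simp
qed

section \<open>Scalars and genericity of the variables\<close>

abbreviation scalar :: "coef \<Rightarrow> ratfun" where
  "scalar c \<equiv> to_fract (lconst c)"

interpretation scalar_hom: ring_hom scalar
  by unfold_locales (simp_all add: lconst_hom.hom_add lconst_hom.hom_mult lconst_hom.hom_1)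

lemma lconst_eq_iff [simp]: "lconst x = lconst y \<longleftrightarrow> x = y"
  by (auto simp: lconst_def dest: arg_cong [of _ _ "\<lambda>P. Poly_Mapping.lookup P 0"])

lemma lconst_eq_0_iff [simp]: "lconst x = 0 \<longleftrightarrow> x = 0"
  using lconst_eq_iff [of x 0] by (simp add: lconst_hom.hom_0)

lemma scalar_inverse: "scalar (inverse x) = inverse (scalar x)"
proof (cases "x = 0")
  case False
  then have "scalar x * scalar (inverse x) = 1"
    by (simp add: scalar_hom.hom_mult [symmetric] scalar_hom.hom_1 del: to_fract_mult)
  then show ?thesis by (rule inverse_unique [symmetric])
qed (simp add: scalar_hom.hom_0)

lemma scalar_divide: "scalar (x / y) = scalar x / scalar y"
  by (simp add: divide_inverse scalar_hom.hom_mult scalar_inverse)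

lemma scalar_angle: "scalar (angle x) = angle (scalar x)"
  by (simp add: angle_def scalar_hom.hom_diff scalar_inverse)

lemma scalar_joukowski: "scalar (joukowski x) = joukowski (scalar x)"
  by (simp add: joukowski_def scalar_hom.hom_add scalar_inverse)

lemma roots_nonzero [simp]:
  "root_a \<noteq> 0" "root_b \<noteq> 0" "root_c \<noteq> 0" "root_d \<noteq> 0" "root_q \<noteq> 0" "root_t \<noteq> 0"
  by (simp_all add: root_a_def root_b_def root_c_def root_d_def root_q_def root_t_def)

lemma root_t_power_neq_1: "k \<ge> 1 \<Longrightarrow> root_t ^ k \<noteq> 1"
proof
  assume k: "k \<ge> 1" and "root_t ^ k = 1"
  then have "[:0, 1:] ^ k = (1 :: rat poly poly poly poly poly poly)"
    by (simp add: root_t_def to_fract_hom.hom_power [symmetric] to_fract_1 [symmetric] del: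
        to_fract_1)
  then have "poly ([:0, 1:] ^ k) 0 = (1 :: rat poly poly poly poly poly)" by simp
  then show False using k by (simp add: power_0_left)
qed

lemma root_q_square_neq_1: "root_q ^ 2 \<noteq> 1"
proof
  assume "root_q ^ 2 = 1"
  then have "[:[:0, 1:]:] ^ 2 = (1 :: rat poly poly poly poly poly poly)"
    by (simp add: root_q_def to_fract_hom.hom_power [symmetric] to_fract_1 [symmetric] del:
        to_fract_1)
  then have "poly (poly ([:[:0, 1:]:] ^ 2) 0) 0 = (1 :: rat poly poly poly poly)" by simp
  then show False by simp
qed

text \<open>The monomial involves the indeterminate \<open>d\<^sup>1\<^sup>/\<^sup>2\<close>. Specialising it to \<open>0\<close>, after \<open>t\<^sup>1\<^sup>/\<^sup>2\<close>
  and \<open>q\<^sup>1\<^sup>/\<^sup>2\<close> have been set to \<open>1\<close>, would give \<open>0 = 1\<close>.\<close>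

lemma root_abcd_square_neq_1: "(root_t ^ n * root_a * root_b * root_c * root_d) ^ 2 \<noteq> 1"
proof
  let ?M = "[:0, 1:] ^ n * [:[:[:[:[:[:0, 1:]:]:]:]:]:] * [:[:[:[:[:0, 1:]:]:]:]:] *
      [:[:[:[:0, 1:]:]:]:] * [:[:[:0, 1:]:]:]
    :: rat poly poly poly poly poly poly"
  assume "(root_t ^ n * root_a * root_b * root_c * root_d) ^ 2 = 1"
  then have "to_fract (?M ^ 2) = to_fract 1"
    by (simp only: root_a_def root_b_def root_c_def root_d_def root_t_def
        to_fract_hom.hom_power to_fract_hom.hom_mult to_fract_1)
  then have "?M ^ 2 = 1" by (simp only: to_fract_eq_iff)
  then have "poly (poly (poly (?M ^ 2) 1) 1) 0 = (1 :: rat poly poly poly)" by simp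
  then show False by (simp add: poly_mult poly_power)
qed

lemma bracket_nonzero: "x ^ 2 \<noteq> 1 \<Longrightarrow> x \<noteq> 0 \<Longrightarrow> bracket x \<noteq> 0"
  by (auto simp: bracket_def power2_eq_square field_simps)

lemma bracket_eq_angle: "bracket = angle"
  by (simp add: fun_eq_iff bracket_def angle_def)

interpretation K: koornwinder_parameters root_a root_b root_c root_d root_q root_t
  by unfold_locales (simp_all add: root_t_power_neq_1)

interpretation Kz: koornwinder_parameters "scalar root_a" "scalar root_b" "scalar root_c"
    "scalar root_d" "scalar root_q" "scalar root_t"
proof unfold_locales
  have "scalar (root_t ^ 2) \<noteq> scalar 1" using root_t_power_neq_1 [of 2] by simp
  then show "scalar root_t ^ 2 \<noteq> 1" by (simp add: scalar_hom.hom_power scalar_hom.hom_1)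
qed simp_all

lemma Kz_node: "Kz.node k = scalar (K.node k)"
  by (simp add: K.node_def Kz.node_def scalar_joukowski scalar_hom.hom_mult scalar_hom.hom_power)

lemma Kz_diag_coeff: "Kz.diag_coeff k = scalar (K.diag_coeff k)"
  by (simp add: K.diag_coeff_def Kz.diag_coeff_def scalar_angle scalar_divide scalar_hom.hom_mult
      scalar_hom.hom_power)

lemma Kz_lower_coeff: "Kz.lower_coeff k = scalar (K.lower_coeff k)"
  by (simp add: K.lower_coeff_def Kz.lower_coeff_def scalar_angle scalar_divide
      scalar_hom.hom_mult scalar_hom.hom_power)

text \<open>Compare the coefficients of \<open>z\<^sub>i\<^sup>2\<close>.\<close>

lemma scaled_zvar_square_neq:
  assumes "u \<noteq> 0"
  shows "scalar u * zvar i ^ 2 \<noteq> scalar v"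
proof
  assume "scalar u * zvar i ^ 2 = scalar v"
  moreover have "zvar i ^ 2 = to_fract (lvar_pow i 2)"
    by (simp add: zvar_def power2_eq_square lvar_pow_def mult_single single_add [symmetric]
        flip: to_fract_mult)
  ultimately have "lconst u * lvar_pow i 2 = lconst v"
    by (simp flip: to_fract_mult)
  then have "Poly_Mapping.lookup (lconst u * lvar_pow i 2) (Poly_Mapping.single i 2) =
      Poly_Mapping.lookup (lconst v) (Poly_Mapping.single i 2)" by simp
  moreover have "Poly_Mapping.single i (2::int) \<noteq> 0"
    by (metis lookup_single_eq lookup_zero zero_neq_numeral)
  ultimately show False
    using assms unfolding lookup_lconst_mult
        by (simp add: lvar_pow_def lconst_def lookup_single when_def)
qed

lemma to_fract_sym_var: "to_fract (sym_var i) = joukowski (zvar i)"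
  by (simp add: sym_var_def joukowski_def to_fract_lvar_pow) (simp add: zvar_def)

lemma joukowski_zvar_inj:
  assumes "joukowski (zvar i) = joukowski (zvar j)"
  shows "i = j"
proof (rule ccontr)
  assume "i \<noteq> j"
  have "sym_var i = sym_var j" using assms by (simp flip: to_fract_sym_var)
  then have "Poly_Mapping.lookup (sym_var i) (Poly_Mapping.single i 1) =
      Poly_Mapping.lookup (sym_var j) (Poly_Mapping.single i 1)"
    by simp
  moreover have "Poly_Mapping.single k e \<noteq> Poly_Mapping.single i (1::int)" if "k \<noteq> i \<or> e \<noteq> 1"
      for k e
  proof
    assume "Poly_Mapping.single k e = Poly_Mapping.single i 1"
    then have "Poly_Mapping.lookup (Poly_Mapping.single k e) i = 1" by simp
    then show False using that by (auto simp: lookup_single when_def split: if_splits)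
  qed
  ultimately show False
    using \<open>i \<noteq> j\<close> by (simp add: sym_var_def lvar_pow_def lookup_add lookup_single when_def)
qed

lemma generic_point_zvar: "Kz.generic_point m zvar"
proof -
  have "zvar i ^ 2 \<noteq> 1" "scalar root_t ^ 2 * zvar i ^ 2 \<noteq> 1" "zvar i ^ 2 \<noteq> scalar root_t ^ 2"
    "scalar root_q ^ 2 * zvar i ^ 2 \<noteq> 1" "zvar i ^ 2 \<noteq> scalar root_q ^ 2" for i
    using scaled_zvar_square_neq [of 1 i 1] scaled_zvar_square_neq [of "root_t ^ 2" i 1]
      scaled_zvar_square_neq [of 1 i "root_t ^ 2"] scaled_zvar_square_neq [of "root_q ^ 2" i 1]
      scaled_zvar_square_neq [of 1 i "root_q ^ 2"]
    by (simp_all add: scalar_hom.hom_1 scalar_hom.hom_power)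
  then show ?thesis
    by (auto simp: Kz.generic_point_def inj_on_def intro: joukowski_zvar_inj)
qed

section \<open>Triangularity between the \<open>E\<^sub>s\<close> and the orbit sums\<close>

definition laurent_esym :: "(nat \<Rightarrow> coef) \<Rightarrow> nat \<Rightarrow> nat \<Rightarrow> laurent" where
  "laurent_esym a m s = interp_esym (\<lambda>k. lconst (a k)) sym_var m s"

lemma E_poly_eq: "E_poly m s par_a par_t = laurent_esym K.node m s"
  unfolding E_poly_def laurent_esym_def interp_esym_eq_sum_increasing_tuples [symmetric]
  by (intro sum.cong prod.cong refl)
    (simp add: bracket2_def sym_var_def K.node_def joukowski_def lconst_hom.hom_add par_a_def
        par_t_def)

lemma orbit_sum_column_laurent_esym: "s \<le> m \<Longrightarrow> orbit_sum m (column s) = laurent_esym (\<lambda>_. 0) m s"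
  by (simp add: orbit_sum_column laurent_esym_def lconst_hom.hom_0)

lemma lsubst_laurent_esym:
  assumes "\<And>i. f i \<noteq> 0"
  shows "lsubst f (laurent_esym a m s) = interp_esym (\<lambda>k. scalar (a k)) (\<lambda>i. joukowski (f i)) m s"
proof -
  interpret ring_hom "lsubst f" using assms by (rule ring_hom_lsubst)
  have "lsubst f (sym_var i) = joukowski (f i)" for i
    by (simp add: sym_var_def joukowski_def hom_add lsubst_lvar_pow power_int_minus)
  then show ?thesis
    by (simp add: laurent_esym_def hom_interp_esym lsubst_lconst)
qed

lemma to_fract_laurent_esym:
  "to_fract (laurent_esym a m s) = interp_esym (\<lambda>k. scalar (a k)) (\<lambda>i. joukowski (zvar i)) m s"
  by (simp add: laurent_esym_def to_fract_hom.hom_interp_esym to_fract_sym_var)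

text \<open>The transition matrix of \<open>interp_esym_node_change\<close> is unitriangular with scalar entries, so
  combinations of the first \<open>r + 1\<close> polynomials are preserved together with their top coefficient.\<close>

lemma triangular_node_change:
  assumes "r \<le> m"
  shows "\<exists>w. (\<Sum>s\<le>r. lconst (v s) * laurent_esym b m s) =
      (\<Sum>s\<le>r. lconst (w s) * laurent_esym a m s) \<and> w r = v r"
proof -
  define k where "k s j = (-1) ^ (s - j) * node_change a b (m - j) (m - s)" for s j
  have "laurent_esym b m s = (\<Sum>j\<le>s. lconst (k s j) * laurent_esym a m j)" if "s \<le> r" for s
    using interp_esym_node_change [of s m "\<lambda>k. lconst (b k)" sym_var "\<lambda>k. lconst (a k)"] that assms
    by (simp add: laurent_esym_def k_def lconst_hom.hom_mult lconst_hom.hom_power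
        lconst_hom.hom_minus
        lconst_hom.hom_1 lconst_hom.hom_node_change)
  then have "(\<Sum>s\<le>r. lconst (v s) * laurent_esym b m s) =
      (\<Sum>s\<le>r. \<Sum>j\<le>s. lconst (v s * k s j) * laurent_esym a m j)"
    by (simp add: sum_distrib_left lconst_hom.hom_mult mult.assoc)
  also have "\<dots> = (\<Sum>j\<le>r. \<Sum>s\<in>{j..r}. lconst (v s * k s j) * laurent_esym a m j)"
    unfolding sum.Sigma [OF finite_atMost ballI [OF finite_atLeastAtMost]] sum.Sigma
        [OF finite_atMost ballI [OF finite_atMost]]
    by (rule sum.reindex_bij_witness [of _ prod.swap prod.swap]) auto
  also have "\<dots> = (\<Sum>j\<le>r. lconst (\<Sum>s\<in>{j..r}. v s * k s j) * laurent_esym a m j)"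
    by (simp add: lconst_hom.hom_sum sum_distrib_right)
  finally show ?thesis
    by (intro exI [of _ "\<lambda>j. \<Sum>s\<in>{j..r}. v s * k s j"]) (simp add: k_def node_change_diag)
qed

text \<open>Pass to orbit sums from the top down: the highest coefficient is unchanged by the
  transition and must vanish.\<close>

lemma laurent_esym_independent:
  assumes "(\<Sum>s\<le>r. lconst (v s) * laurent_esym a m s) = 0" and "r \<le> m" and "s \<le> r"
  shows "v s = 0"
  using assms
proof (induction r)
  case (Suc r)
  obtain w where w: "(\<Sum>s\<le>Suc r. lconst (v s) * laurent_esym a m s) =
      (\<Sum>s\<le>Suc r. lconst (w s) * laurent_esym (\<lambda>_. 0) m s)"
    and top: "w (Suc r) = v (Suc r)"
    using triangular_node_change [OF Suc.prems(2)] by blast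
  have "(\<Sum>s\<le>Suc r. lconst (w s) * orbit_sum m (column s)) =
      (\<Sum>s\<le>Suc r. lconst (w s) * laurent_esym (\<lambda>_. 0) m s)"
    using Suc.prems(2) by (intro sum.cong) (auto simp: orbit_sum_column_laurent_esym)
  then have "w (Suc r) = 0"
    using orbit_sum_column_independent [of w m "Suc r" "Suc r"] Suc.prems w by simp
  then have "v (Suc r) = 0" using top by simp
  then show ?case
    using Suc by (cases "s = Suc r") (auto simp: lconst_hom.hom_0)
qed (simp add: laurent_esym_def)

section \<open>Koornwinder polynomials of columns as eigenvectors\<close>

lemma koornwinder_D_add: "koornwinder_D m (P + Q) = koornwinder_D m P + koornwinder_D m Q"
  unfolding koornwinder_D_def q_shift_def q_shift_inv_def
  by (simp add: lsubst_add distrib_left sum.distrib [symmetric] right_diff_distrib sum_subtractf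
      [symmetric] algebra_simps)

lemma q_shift_nonzero: "u \<noteq> 0 \<Longrightarrow> (zvar(i := scalar u * zvar i)) k \<noteq> 0"
  by simp

lemma koornwinder_D_lconst_mult: "koornwinder_D m (lconst c * P) = scalar c * koornwinder_D m P"
proof -
  have "lsubst (zvar(i := scalar u * zvar i)) (lconst c * P) = scalar c *
      lsubst (zvar(i := scalar u * zvar i)) P" if "u \<noteq> 0" for u i
    by (subst lsubst_mult [OF q_shift_nonzero [OF that]]) (simp add: lsubst_lconst)
  then show ?thesis
    unfolding koornwinder_D_def q_shift_def q_shift_inv_def
    by (simp add: par_q_def distrib_left sum_distrib_left algebra_simps)
qed

lemma koornwinder_D_sum: "koornwinder_D m (\<Sum>s\<in>A. P s) = (\<Sum>s\<in>A. koornwinder_D m (P s))"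
proof (induction A rule: infinite_finite_induct)
  have "koornwinder_D m 0 = 0"
    using koornwinder_D_lconst_mult [of m 0 0] by (simp add: lconst_hom.hom_0)
  then show "koornwinder_D m (\<Sum>s\<in>{}. P s) = (\<Sum>s\<in>{}. koornwinder_D m (P s))"
    and "\<And>A. infinite A \<Longrightarrow> koornwinder_D m (\<Sum>s\<in>A. P s) = (\<Sum>s\<in>A. koornwinder_D m (P s))" by simp_all
qed (simp add: koornwinder_D_add)

lemma koornwinder_A_plus_eq: "koornwinder_A_plus m i z = Kz.A_plus m i z"
  by (simp add: koornwinder_A_plus_def Kz.A_plus_def Let_def par_a_def par_b_def par_c_def par_d_def
      par_q_def par_t_def scalar_hom.hom_power scalar_hom.hom_mult scalar_divide)

definition eigenvalue :: "nat \<Rightarrow> nat \<Rightarrow> coef" where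
  "eigenvalue m s = bracket root_q * (K.diag_coeff m - K.diag_coeff (m - s))"

definition lowering :: "nat \<Rightarrow> nat \<Rightarrow> coef" where
  "lowering m s = bracket root_q * K.lower_coeff (m - s)"

text \<open>The point with coordinates \<open>z\<^sub>i\<close> is generic, and both instances of the locale have the same
  coefficients up to the embedding of scalars.\<close>

lemma koornwinder_D_esym:
  assumes "m \<ge> 1" "s \<le> m"
  shows "koornwinder_D m (laurent_esym K.node m s) =
      to_fract (lconst (eigenvalue m s) * laurent_esym K.node m s +
    (if s = 0 then 0 else lconst (lowering m (s - 1)) * laurent_esym K.node m (s - 1)))"
proof -
  have shift: "lsubst (zvar(i := scalar u * zvar i)) (laurent_esym K.node m s) =
      interp_esym Kz.node ((\<lambda>k. joukowski (zvar k))(i := joukowski (scalar u * zvar i))) m s"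
          if "u \<noteq> 0" for u i
  proof -
    have "(\<lambda>k. joukowski ((zvar(i := scalar u * zvar i)) k)) =
        (\<lambda>k. joukowski (zvar k))(i := joukowski (scalar u * zvar i))"
      by auto
    moreover have "Kz.node = (\<lambda>k. scalar (K.node k))" by (simp add: fun_eq_iff Kz_node)
    ultimately show ?thesis
      by (simp only: lsubst_laurent_esym [OF q_shift_nonzero [OF that]])
  qed
  have "Kz.node = (\<lambda>k. scalar (K.node k))" by (simp add: fun_eq_iff Kz_node)
  then have tf: "to_fract (laurent_esym K.node m s) =
      interp_esym Kz.node (\<lambda>i. joukowski (zvar i)) m s" for s
    by (simp only: to_fract_laurent_esym)
  have q: "scalar par_q = scalar root_q ^ 2"
      "scalar (inverse par_q) = inverse (scalar root_q ^ 2)" "par_q \<noteq> 0" "inverse par_q \<noteq> 0"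
    by (simp_all add: par_q_def scalar_hom.hom_power scalar_inverse)
  have "koornwinder_D m (laurent_esym K.node m s) = Kz.difference_op m zvar (Kz.E m s)"
    unfolding koornwinder_D_def q_shift_def q_shift_inv_def Kz.difference_op_def Let_def
      shift [OF q(3)] shift [OF q(4)] tf koornwinder_A_minus_def koornwinder_A_plus_eq
    unfolding q(1,2) ..
  also have "\<dots> = to_fract (lconst (eigenvalue m s) * laurent_esym K.node m s +
    (if s = 0 then 0 else lconst (lowering m (s - 1)) * laurent_esym K.node m (s - 1)))"
    unfolding Kz.difference_op_interp_esym [OF generic_point_zvar assms]
    by (simp add: tf eigenvalue_def lowering_def bracket_eq_angle scalar_hom.hom_mult
        scalar_hom.hom_diff scalar_angle
        Kz_diag_coeff Kz_lower_coeff algebra_simps)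
  finally show ?thesis .
qed

text \<open>Compare coefficients with respect to the linearly independent \<open>E\<^sub>s\<close>.\<close>

lemma koornwinder_D_eigen_iff:
  assumes "m \<ge> 1" "r \<le> m"
  shows "koornwinder_D m (\<Sum>s\<le>r. lconst (u s) * laurent_esym K.node m s) =
      scalar d * to_fract (\<Sum>s\<le>r. lconst (u s) * laurent_esym K.node m s) \<longleftrightarrow>
    (\<forall>s\<le>r. eigenvalue m s * u s + (if s < r then lowering m s * u (Suc s) else 0) = d * u s)"
proof -
  let ?E = "laurent_esym K.node m"
  let ?v = "\<lambda>s. eigenvalue m s * u s + (if s < r then lowering m s * u (Suc s) else 0)"
  have lower: "(\<Sum>s\<le>r. if s = 0 then 0 else lconst (u s * lowering m (s - 1)) * ?E (s - 1)) =
      (\<Sum>s\<le>r. lconst (if s < r then lowering m s * u (Suc s) else 0) * ?E s)"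
  proof (cases r)
    case (Suc n)
    have "(\<Sum>s\<le>Suc n. if s = 0 then 0 else lconst (u s * lowering m (s - 1)) * ?E (s - 1)) =
        (\<Sum>s\<le>n. lconst (u (Suc s) * lowering m s) * ?E s)"
      unfolding sum.atMost_Suc_shift by simp
    also have "\<dots> = (\<Sum>s\<le>n. lconst (if s < Suc n then lowering m s * u (Suc s) else 0) * ?E s)"
      by (intro sum.cong refl) (simp add: mult.commute)
    also have "\<dots> = (\<Sum>s\<le>Suc n. lconst (if s < Suc n then lowering m s * u (Suc s) else 0) * ?E s)"
      by (simp add: lconst_hom.hom_0)
    finally show ?thesis unfolding Suc .
  qed (simp add: lconst_hom.hom_0)
  have "koornwinder_D m (\<Sum>s\<le>r. lconst (u s) * ?E s) =
    to_fract (\<Sum>s\<le>r. lconst (u s) * (lconst (eigenvalue m s) * ?E s +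
      (if s = 0 then 0 else lconst (lowering m (s - 1)) * ?E (s - 1))))"
    unfolding koornwinder_D_sum koornwinder_D_lconst_mult to_fract_hom.hom_sum to_fract_mult [of
        "lconst (u _)"]
    using assms by (intro sum.cong refl) (simp add: koornwinder_D_esym)
  also have "(\<Sum>s\<le>r. lconst (u s) * (lconst (eigenvalue m s) * ?E s +
      (if s = 0 then 0 else lconst (lowering m (s - 1)) * ?E (s - 1)))) =
      (\<Sum>s\<le>r. lconst (eigenvalue m s * u s) * ?E s) +
      (\<Sum>s\<le>r. if s = 0 then 0 else lconst (u s * lowering m (s - 1)) * ?E (s - 1))"
    unfolding sum.distrib [symmetric]
    by (intro sum.cong refl) (simp add: lconst_hom.hom_mult algebra_simps)
  also have "\<dots> = (\<Sum>s\<le>r. lconst (?v s) * ?E s)"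
    unfolding lower sum.distrib [symmetric] lconst_hom.hom_add distrib_right ..
  finally have "koornwinder_D m (\<Sum>s\<le>r. lconst (u s) * ?E s) = scalar d *
      to_fract (\<Sum>s\<le>r. lconst (u s) * ?E s) \<longleftrightarrow>
      (\<Sum>s\<le>r. lconst (?v s) * ?E s) = lconst d * (\<Sum>s\<le>r. lconst (u s) * ?E s)"
    by (simp only: to_fract_mult [symmetric] to_fract_eq_iff)
  also have "\<dots> \<longleftrightarrow> (\<Sum>s\<le>r. lconst (?v s - d * u s) * ?E s) = 0"
    unfolding lconst_hom.hom_diff left_diff_distrib sum_subtractf lconst_hom.hom_mult [of d]
        sum_distrib_left mult.assoc right_minus_eq ..
  also have "\<dots> \<longleftrightarrow> (\<forall>s\<le>r. ?v s - d * u s = 0)"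
  proof
    assume "(\<Sum>s\<le>r. lconst (?v s - d * u s) * ?E s) = 0"
    from laurent_esym_independent [OF this assms(2)] show "\<forall>s\<le>r. ?v s - d * u s = 0" by blast
  qed (simp add: lconst_hom.hom_0)
  finally show ?thesis by simp
qed

lemma W_invariant_laurent_esym:
  assumes "s \<le> m"
  shows "W_invariant m (laurent_esym a m s)"
  unfolding W_invariant_def
proof (intro allI impI, elim conjE)
  fix \<sigma> \<epsilon> assume \<sigma>: "\<sigma> permutes {1..m}" and \<epsilon>: "sign_vector m \<epsilon>"
  have "lsubst (\<lambda>i. zvar (\<sigma> i) powi \<epsilon> i) (laurent_esym a m s) =
      interp_esym (\<lambda>k. scalar (a k)) (\<lambda>i. joukowski (zvar (\<sigma> i) powi \<epsilon> i)) m s"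
    by (rule lsubst_laurent_esym) simp
  also have "\<dots> = interp_esym (\<lambda>k. scalar (a k)) (\<lambda>i. joukowski (zvar (\<sigma> i))) m s"
  proof (rule interp_esym_cong)
    fix i assume "i \<in> {1..m}"
    then have "\<epsilon> i = 1 \<or> \<epsilon> i = -1" using \<epsilon> by (auto simp: sign_vector_def)
    then show "joukowski (zvar (\<sigma> i) powi \<epsilon> i) = joukowski (zvar (\<sigma> i))"
      by (auto simp: power_int_minus)
  qed
  also have "\<dots> = to_fract (laurent_esym a m s)"
    unfolding to_fract_laurent_esym
    by (rule interp_esym_permute [OF \<sigma> assms, of _ "\<lambda>i. joukowski (zvar i)"])
  finally show "lsubst (\<lambda>i. zvar (\<sigma> i) powi \<epsilon> i) (laurent_esym a m s) =
      to_fract (laurent_esym a m s)" .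
qed

lemma W_invariant_sum:
  assumes "\<And>s. s \<in> A \<Longrightarrow> W_invariant m (P s)"
  shows "W_invariant m (\<Sum>s\<in>A. lconst (u s) * P s)"
  unfolding W_invariant_def
proof (intro allI impI)
  fix \<sigma> \<epsilon> assume *: "\<sigma> permutes {1..m} \<and> sign_vector m \<epsilon>"
  interpret ring_hom "lsubst (\<lambda>i. zvar (\<sigma> i) powi \<epsilon> i)"
    by (rule ring_hom_lsubst) simp
  show "lsubst (\<lambda>i. zvar (\<sigma> i) powi \<epsilon> i) (\<Sum>s\<in>A. lconst (u s) * P s) =
      to_fract (\<Sum>s\<in>A. lconst (u s) * P s)"
    using assms * by (simp add: hom_sum hom_mult lsubst_lconst to_fract_hom.hom_sum W_invariant_def)
qed

lemma laurent_in_orbit_sums: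
  assumes "r \<le> m"
  shows "(\<Sum>s\<le>r. lconst (w s) * orbit_sum m (column s)) \<in> laurent_in m"
proof -
  have "Poly_Mapping.keys \<nu> \<subseteq> {1..m}"
    if \<nu>: "Poly_Mapping.lookup (\<Sum>s\<le>r. lconst (w s) * orbit_sum m (column s)) \<nu> \<noteq> 0" for \<nu>
  proof -
    obtain s where s: "s \<le> r" "Poly_Mapping.lookup (orbit_sum m (column s)) \<nu> \<noteq> 0"
      using \<nu> unfolding lookup_sum lookup_lconst_mult
          by (metis (no_types, lifting) atMost_iff mult_zero_right sum.neutral)
    then have "\<nu> \<in> sign_exponents m s"
      using assms finite_sign_exponents [of m s]
      by (auto simp: orbit_sum_def W_orbit_column lookup_sum lookup_single when_def split:
          if_splits)
    then show ?thesis by (simp add: sign_exponents_def)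
  qed
  then show ?thesis by (auto simp: laurent_in_def in_keys_iff)
qed

lemma inj_column: "inj column"
proof (rule linorder_injI)
  fix s r :: nat assume "s < r"
  then have "column s r = 0" "column r r = 1" by (simp_all add: column_def)
  then show "column s \<noteq> column r" by auto
qed

text \<open>The dominance condition for \<open>i = 1\<close> bounds the parts by \<open>1\<close>, so the partition is a column;
  for \<open>i = m\<close> it bounds its length by \<open>r\<close>.\<close>

lemma partitions_below_column:
  assumes "m \<ge> 1" "r \<le> m"
  shows "{\<mu>. \<mu> \<in> partitions_le m \<and> dominated m \<mu> (column r) \<and> \<mu> \<noteq> column r} = column ` {..<r}"
proof (intro equalityI subsetI)
  fix \<mu> assume "\<mu> \<in> {\<mu>. \<mu> \<in> partitions_le m \<and> dominated m \<mu> (column r) \<and> \<mu> \<noteq> column r}"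
  then have decr: "\<And>i j. i \<in> {1..m} \<Longrightarrow> j \<in> {1..m} \<Longrightarrow> i \<le> j \<Longrightarrow> \<mu> j \<le> \<mu> i"
    and zero: "\<And>i. i \<notin> {1..m} \<Longrightarrow> \<mu> i = 0"
    and dom: "\<And>i. i \<in> {1..m} \<Longrightarrow> (\<Sum>j=1..i. \<mu> j) \<le> (\<Sum>j=1..i. column r j)"
    and ne: "\<mu> \<noteq> column r"
    by (auto simp: partitions_le_def dominated_def)
  have "\<mu> 1 \<le> column r 1" using dom [of 1] assms by simp
  then have "\<mu> 1 \<le> 1" by (simp add: column_def split: if_splits)
  then have le1: "\<mu> i \<le> 1" for i
    using decr [of 1 i] zero [of i] assms by (cases "i \<in> {1..m}") auto
  \<comment> \<open>The last index with part \<open>1\<close>; the inserted \<open>0\<close> covers the empty partition.\<close>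
  define k where "k = Max (insert 0 {i \<in> {1..m}. \<mu> i = 1})"
  have kin: "k \<in> insert 0 {i \<in> {1..m}. \<mu> i = 1}"
    unfolding k_def by (rule Max_in) auto
  have above: "\<mu> i = 0" if "i > k" for i
  proof (rule ccontr)
    assume "\<mu> i \<noteq> 0"
    then have "\<mu> i = 1" "i \<in> {1..m}" using le1 [of i] zero [of i] by auto
    then have "i \<le> k" unfolding k_def by (intro Max_ge) auto
    then show False using that by simp
  qed
  have \<mu>: "\<mu> = column k"
  proof
    fix i
    show "\<mu> i = column k i"
    proof (cases "i \<in> {1..k}")
      case True
      then have "k \<in> {1..m}" "\<mu> k = 1" using kin by auto
      then have "\<mu> i \<ge> 1" using decr [of i k] True by auto
      then show ?thesis using le1 [of i] True by (simp add: column_def)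
    next
      case False
      then show ?thesis using above [of i] zero [of i] by (auto simp: column_def)
    qed
  qed
  have "(\<Sum>j=1..m. column k j) = k" if "k \<le> m" for k
  proof -
    have "(\<Sum>j=1..m. column k j) = (\<Sum>j\<in>{1..k}. 1)"
      using that by (intro sum.mono_neutral_cong_right) (auto simp: column_def)
    then show ?thesis by simp
  qed
  then have "k \<le> r" using dom [of m] assms kin by (auto simp: \<mu>)
  then show "\<mu> \<in> column ` {..<r}" using \<mu> ne by (cases "k = r") auto
next
  fix \<mu> assume "\<mu> \<in> column ` {..<r}"
  then obtain s where s: "s < r" "\<mu> = column s" by auto
  have "column s \<noteq> column r" using s inj_column by (auto dest: injD)
  moreover have "dominated m (column s) (column r)"
    using s by (auto simp: dominated_def column_def intro!: sum_mono)
  moreover have "column s \<in> partitions_le m"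
    using s assms by (auto simp: partitions_le_def column_def)
  ultimately show "\<mu> \<in> {\<mu>. \<mu> \<in> partitions_le m \<and> dominated m \<mu> (column r) \<and> \<mu> \<noteq> column r}"
    using s by simp
qed

text \<open>Combinations of the \<open>E\<^sub>s\<close> are invariant Laurent polynomials in \<open>z\<^sub>1, \<dots>, z\<^sub>m\<close>. The shape of
  the leading term translates by \<open>triangular_node_change\<close> and the eigenvalue equation by
  \<open>koornwinder_D_eigen_iff\<close>.\<close>

lemma is_koornwinder_column_iff:
  assumes "m \<ge> 1" "r \<le> m"
  shows "is_koornwinder m (column r) P \<longleftrightarrow>
    (\<exists>u d. P = (\<Sum>s\<le>r. lconst (u s) * laurent_esym K.node m s) \<and> u r = 1 \<and>
      (\<forall>s\<le>r. eigenvalue m s * u s + (if s < r then lowering m s * u (Suc s) else 0) = d * u s))"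
proof
  assume P: "is_koornwinder m (column r) P"
  then obtain c d where c: "P = orbit_sum m (column r) +
      (\<Sum>\<mu>\<in>column ` {..<r}. lconst (c \<mu>) * orbit_sum m \<mu>)"
    and d: "koornwinder_D m P = scalar d * to_fract P"
    unfolding is_koornwinder_def partitions_below_column [OF assms] by blast
  define v where "v s = (if s = r then 1 else c (column s))" for s
  have "(\<Sum>\<mu>\<in>column ` {..<r}. lconst (c \<mu>) * orbit_sum m \<mu>) =
      (\<Sum>s<r. lconst (v s) * orbit_sum m (column s))"
    by (subst sum.reindex [OF inj_on_subset [OF inj_column subset_UNIV]]) (auto simp: v_def)
  then have "P = (\<Sum>s\<le>r. lconst (v s) * orbit_sum m (column s))"
    by (simp add: c v_def lconst_hom.hom_1 lessThan_Suc_atMost [symmetric] add.commute)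
  also have "\<dots> = (\<Sum>s\<le>r. lconst (v s) * laurent_esym (\<lambda>_. 0) m s)"
    using assms by (intro sum.cong) (auto simp: orbit_sum_column_laurent_esym)
  finally obtain u where u: "P = (\<Sum>s\<le>r. lconst (u s) * laurent_esym K.node m s)" "u r = v r"
    using triangular_node_change [OF assms(2), of v "\<lambda>_. 0" K.node] by auto
  show "\<exists>u d. P = (\<Sum>s\<le>r. lconst (u s) * laurent_esym K.node m s) \<and> u r = 1 \<and>
      (\<forall>s\<le>r. eigenvalue m s * u s + (if s < r then lowering m s * u (Suc s) else 0) = d * u s)"
    using u d koornwinder_D_eigen_iff [OF assms, of u d]
    by (intro exI [of _ u] exI [of _ d]) (simp add: v_def)
next
  assume "\<exists>u d. P = (\<Sum>s\<le>r. lconst (u s) * laurent_esym K.node m s) \<and> u r = 1 \<and>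
      (\<forall>s\<le>r. eigenvalue m s * u s + (if s < r then lowering m s * u (Suc s) else 0) = d * u s)"
  then obtain u d where u: "P = (\<Sum>s\<le>r. lconst (u s) * laurent_esym K.node m s)" "u r = 1"
    and d: "koornwinder_D m P = scalar d * to_fract P"
    using koornwinder_D_eigen_iff [OF assms] by blast
  obtain w where w: "P = (\<Sum>s\<le>r. lconst (w s) * laurent_esym (\<lambda>_. 0) m s)" "w r = 1"
    using triangular_node_change [OF assms(2), of u K.node "\<lambda>_. 0"] u by auto
  have Pw: "P = (\<Sum>s\<le>r. lconst (w s) * orbit_sum m (column s))"
    unfolding w(1) using assms by (intro sum.cong) (auto simp: orbit_sum_column_laurent_esym)
  define c where "c \<mu> = w (inv column \<mu>)" for \<mu>
  have "(\<Sum>\<mu>\<in>column ` {..<r}. lconst (c \<mu>) * orbit_sum m \<mu>) =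
      (\<Sum>s<r. lconst (w s) * orbit_sum m (column s))"
    by (subst sum.reindex [OF inj_on_subset [OF inj_column subset_UNIV]])
      (simp add: c_def inv_f_f [OF inj_column])
  then have "P = orbit_sum m (column r) + (\<Sum>\<mu>\<in>column ` {..<r}. lconst (c \<mu>) * orbit_sum m \<mu>)"
    by (simp add: Pw w(2) lconst_hom.hom_1 lessThan_Suc_atMost [symmetric] add.commute)
  moreover have "W_invariant m P"
    unfolding u(1) using assms by (intro W_invariant_sum W_invariant_laurent_esym) auto
  moreover have "P \<in> laurent_in m"
    unfolding Pw using assms(2) by (rule laurent_in_orbit_sums)
  ultimately show "is_koornwinder m (column r) P"
    unfolding is_koornwinder_def partitions_below_column [OF assms] using d by blast
qed

section \<open>Solving the eigenvector recursion\<close>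

text \<open>The bracket form of \<open>\<langle>TL\<rangle>\<langle>TLS\<rangle> - \<langle>T\<rangle>\<langle>TS\<rangle> = \<langle>L\<rangle>\<langle>T\<^sup>2LS\<rangle>\<close>, which factorises differences of
  eigenvalues.\<close>

lemma angle_product_difference:
  fixes u v w :: "'a::field"
  assumes "u \<noteq> 0" "v \<noteq> 0" "w \<noteq> 0"
  shows "angle (u * v) * angle (u * v * w) - angle u * angle (u * w) = angle v *
      angle (u ^ 2 * v * w)"
proof -
  define u' v' w' where "u' = inverse u" "v' = inverse v" "w' = inverse w"
  have "u * u' = 1" "v * v' = 1" "w * w' = 1" using assms by (simp_all add: u'_v'_w'_def)
  then have "(u * v - u' * v') * (u * v * w - u' * v' * w') - (u - u') * (u * w - u' * w') =
      (v - v') * (u ^ 2 * v * w - u' ^ 2 * v' * w')"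
    by algebra
  then show ?thesis by (simp add: angle_def u'_v'_w'_def power_inverse)
qed

text \<open>Both eigenvalues share the summand with index \<open>m\<close>; up to the common factor \<open>\<langle>q\<rangle>/\<langle>t\<rangle>\<close> the
  remaining ones have the form \<open>\<langle>T\<rangle>\<langle>TS\<rangle>\<close> with \<open>S = abcd/t\<close> and \<open>T\<close> equal to \<open>t\<^sup>m\<^sup>-\<^sup>s\<close> and
  \<open>t\<^sup>m\<^sup>-\<^sup>r\<close>.\<close>

lemma eigenvalue_difference:
  assumes "s \<le> r" "r \<le> m"
  shows "eigenvalue m r - eigenvalue m s = bracket root_q *
    (bracket (root_t ^ (r - s)) *
        bracket (root_t ^ (2 * (m - r) + (r - s)) *
        (root_a * root_b * root_c * root_d / root_t)) / bracket root_t)"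
proof -
  define T L S where "T = root_t ^ (m - r)" and "L = root_t ^ (r - s)" and
      "S = root_a * root_b * root_c * root_d / root_t"
  have nz: "T \<noteq> 0" "L \<noteq> 0" "S \<noteq> 0" by (simp_all add: T_def L_def S_def)
  have ms: "root_t ^ (m - s) = T * L" using assms by (simp add: T_def L_def flip: power_add)
  have TT: "root_t ^ (2 * (m - r) + (r - s)) = T ^ 2 * L"
    by (simp add: T_def L_def power_add power_mult mult.commute flip: power_mult)
  have "angle (T * L) * angle (T * L * S) - angle T * angle (T * S) = angle L *
      angle (T ^ 2 * L * S)"
    using nz by (rule angle_product_difference)
  then show ?thesis
    by (simp add: eigenvalue_def K.diag_coeff_def bracket_eq_angle TT ms right_diff_distrib
        [symmetric]
        diff_divide_distrib [symmetric] flip: S_def T_def L_def)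
qed

text \<open>The coefficient of \<open>E\<^sub>r\<^sub>-\<^sub>l\<close> in the theorem, with \<open>p = m - r\<close>.\<close>

definition column_coeff :: "nat \<Rightarrow> nat \<Rightarrow> coef" where
  "column_coeff p l = (bracket_fact (root_t ^ (p + 1)) l *
           bracket_fact (root_t ^ p * root_a * root_b) l *
           bracket_fact (root_t ^ p * root_a * root_c) l *
           bracket_fact (root_t ^ p * root_a * root_d) l) /
          (bracket_fact root_t l *
           bracket_fact (root_t ^ (2 * p) * root_a * root_b * root_c * root_d) l)"

lemma bracket_t_power_nonzero: "k \<ge> 1 \<Longrightarrow> bracket (root_t ^ k) \<noteq> 0"
  using root_t_power_neq_1 [of "2 * k"]
      by (intro bracket_nonzero) (simp_all add: power_mult [symmetric] mult.commute)

lemma bracket_abcd_nonzero: "bracket (root_t ^ k * (root_a * root_b * root_c * root_d)) \<noteq> 0"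
  using root_abcd_square_neq_1 [of k] by (intro bracket_nonzero) (simp_all add: mult.assoc)

lemma bracket_fact_Suc: "bracket_fact x (Suc l) = bracket_fact x l * bracket (root_t ^ l * x)"
  by (simp add: bracket_fact_def)

lemma fraction_step:
  fixes u v :: "'a::field"
  assumes "u \<noteq> 0" "v \<noteq> 0"
  shows "a * x * (b * y) * (c * z) * (d * w) / (e * u * (f * v)) * (u * v / t) =
    a * b * c * d / (e * f) * (x * y * z * w / t)"
proof -
  have "a * x * (b * y) * (c * z) * (d * w) = a * b * c * d * (x * y * z * w)"
      "e * u * (f * v) = e * f * (u * v)"
    by (simp_all only: mult_ac)
  moreover have "n * p / (g * h) * (h / t) = n / g * (p / t)" if "h \<noteq> 0" for n p g h
    using that by simp
  ultimately show ?thesis using assms by simp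
qed

text \<open>Consecutive coefficients differ by one bracket in each shifted factorial. In the numerator
  these brackets form \<open>lower_coeff\<close>, in the denominator they form the difference of eigenvalues.\<close>

lemma column_coeff_Suc:
  "column_coeff p (Suc l) * (bracket (root_t ^ Suc l) *
      bracket (root_t ^ (2 * p + Suc l) * (root_a * root_b * root_c * root_d / root_t)) /
          bracket root_t) =
   column_coeff p l * K.lower_coeff (p + Suc l)"
proof -
  have 1: "bracket (root_t ^ Suc l) \<noteq> 0" by (rule bracket_t_power_nonzero) simp
  have 2: "bracket (root_t ^ (2 * p + l) * (root_a * root_b * root_c * root_d)) \<noteq> 0"
    by (rule bracket_abcd_nonzero)
  have e: "root_t ^ (n + Suc l) * (x / root_t) = root_t ^ (n + l) * x" for n x by simp
  have f: "root_t ^ l * (root_t ^ p * x * y) = root_t ^ (p + l) * (x * y)" for x y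
    by (simp add: power_add mult_ac)
  have g: "root_t ^ l * (root_t ^ (2 * p) * root_a * root_b * root_c * root_d) =
      root_t ^ (2 * p + l) * (root_a * root_b * root_c * root_d)"
    by (simp add: power_add mult_ac)
  have h: "root_t ^ l * root_t ^ (p + 1) = root_t ^ (p + Suc l)"
      "root_t ^ l * root_t = root_t ^ Suc l"
    by (simp_all add: power_add mult_ac)
  show ?thesis
    unfolding column_coeff_def bracket_fact_Suc K.lower_coeff_def e f g h bracket_eq_angle
        [symmetric]
    by (rule fraction_step [OF 1 2])
qed

lemma column_coeff_recursion:
  assumes "s < r" "r \<le> m"
  shows "(eigenvalue m r - eigenvalue m s) * column_coeff (m - r) (r - s) =
    lowering m s * column_coeff (m - r) (r - Suc s)"
proof -
  define l where "l = r - Suc s"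
  have l: "r - s = Suc l" "m - s = m - r + Suc l" using assms by (simp_all add: l_def)
  show ?thesis
    unfolding eigenvalue_difference [OF less_imp_le [OF assms(1)] assms(2)] lowering_def l l_def
        [symmetric]
    using column_coeff_Suc [of "m - r" l] by (simp only: mult_ac)
qed

lemma eigenvalue_neq:
  assumes "s < r" "r \<le> m"
  shows "eigenvalue m r \<noteq> eigenvalue m s"
proof -
  define l where "l = r - Suc s"
  have l: "r - s = Suc l" using assms by (simp add: l_def)
  have "bracket (root_t ^ (2 * (m - r) + Suc l) * (root_a * root_b * root_c * root_d / root_t)) \<noteq> 0"
    using bracket_abcd_nonzero [of "2 * (m - r) + l"] by (simp add: mult.assoc)
  moreover have "bracket root_q \<noteq> 0" by (rule bracket_nonzero [OF root_q_square_neq_1]) simp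
  moreover have "bracket root_t \<noteq> 0" using bracket_t_power_nonzero [of 1] by simp
  moreover have "bracket (root_t ^ Suc l) \<noteq> 0" by (rule bracket_t_power_nonzero) simp
  ultimately have "eigenvalue m r - eigenvalue m s \<noteq> 0"
    unfolding eigenvalue_difference [OF less_imp_le [OF assms(1)] assms(2)] l by simp
  then show ?thesis by simp
qed

text \<open>The equation for \<open>s = r\<close> identifies the eigenvalue; then the recursion runs downwards from
  \<open>u\<^sub>r = 1\<close>.\<close>

lemma eigen_recursion_unique:
  assumes r: "r \<le> m" and top: "u r = 1"
    and rec: "\<And>s. s \<le> r \<Longrightarrow> eigenvalue m s * u s + (if s < r then lowering m s * u (Suc s) else 0) =
        d * u s"
    and s: "s \<le> r"
  shows "u s = column_coeff (m - r) (r - s)"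
  using s
proof (induction s rule: inc_induct)
  case base
  then show ?case using top by (simp add: column_coeff_def bracket_fact_def)
next
  case (step s)
  have "d = eigenvalue m r" using rec [of r] top by simp
  then have "(eigenvalue m r - eigenvalue m s) * u s = lowering m s * u (Suc s)"
    using rec [of s] step by (simp add: algebra_simps)
  also have "\<dots> = (eigenvalue m r - eigenvalue m s) * column_coeff (m - r) (r - s)"
    using column_coeff_recursion [of s r m] step r by simp
  finally show ?case using eigenvalue_neq [of s r m] step r by simp
qed

theorem theorem5p1:
  fixes m r :: nat
  assumes "m \<ge> 1" and "r \<le> m"
  shows "koornwinder m (column r) =
    (\<Sum>l=0..r.
       lconst
         ((bracket_fact (root_t ^ (m - r + 1)) l *
           bracket_fact (root_t ^ (m - r) * root_a * root_b) l *
           bracket_fact (root_t ^ (m - r) * root_a * root_c) l *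
           bracket_fact (root_t ^ (m - r) * root_a * root_d) l) /
          (bracket_fact root_t l *
           bracket_fact (root_t ^ (2 * (m - r)) * root_a * root_b * root_c * root_d) l)) *
       E_poly m (r - l) par_a par_t)"
proof -
  define u where "u s = column_coeff (m - r) (r - s)" for s
  define P where "P = (\<Sum>s\<le>r. lconst (u s) * laurent_esym K.node m s)"
  have top: "u r = 1" by (simp add: u_def column_coeff_def bracket_fact_def)
  have "eigenvalue m s * u s + (if s < r then lowering m s * u (Suc s) else 0) =
      eigenvalue m r * u s" if "s \<le> r" for s
    using column_coeff_recursion [of s r m] that assms
    by (cases "s = r") (auto simp: u_def algebra_simps)
  then have "is_koornwinder m (column r) P"
    using top unfolding is_koornwinder_column_iff [OF assms] P_def by blast
  moreover have "Q = P" if Q: "is_koornwinder m (column r) Q" for Q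
  proof -
    obtain v d where v: "Q = (\<Sum>s\<le>r. lconst (v s) * laurent_esym K.node m s)" "v r = 1"
      "\<And>s. s \<le> r \<Longrightarrow> eigenvalue m s * v s + (if s < r then lowering m s * v (Suc s) else 0) = d * v s"
      using Q unfolding is_koornwinder_column_iff [OF assms] by blast
    have "v s = u s" if "s \<le> r" for s
      using eigen_recursion_unique [OF assms(2) v(2,3) that] by (simp add: u_def)
    then show ?thesis unfolding v(1) P_def by (intro sum.cong) auto
  qed
  ultimately have "koornwinder m (column r) = P"
    unfolding koornwinder_def by (rule the_equality)
  also have "P = (\<Sum>l=0..r. lconst (column_coeff (m - r) l) * E_poly m (r - l) par_a par_t)"
    unfolding P_def E_poly_eq
    by (rule sum.reindex_bij_witness [of _ "\<lambda>l. r - l" "\<lambda>s. r - s"]) (auto simp: u_def)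
  finally show ?thesis unfolding column_coeff_def .
qed

end
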